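(* Let $D \geq 1$ be an integer, let $H : \mathbb{R}^D \to \mathbb{R}$ be a $\mathcal{C}^2$ function and let $\psi : \mathbb{R}^D \to \mathbb{R}$ be a Lipschitz and differentiable function whose gradient $\nabla\psi$ is Lipschitz. Let $g$ be the unique (Lipschitz) viscosity solution of $$\begin{cases} \partial_t g - H(\nabla g) = 0 & \text{on } (0,+\infty)\times\mathbb{R}^D,\\ g(0,\cdot)=\psi & \text{on } \mathbb{R}^D.\end{cases}$$ Let $T > 0$. Assume that $g$ is differentiable on $(0,T)\times\mathbb{R}^D$ and that there exists $L \geq 0$ such that for every $t\in[0,T)$ and $x,y\in\mathbb{R}^D$, $$|\nabla g(t,x)-\nabla g(t,y)| \leq L|x-y|.$$ Then there is a unique Lipschitz function $f : [0,T]\times\mathbb{R}^D\to\mathbb{R}$ satisfying the following three properties: 1. $f(0,\cdot)=\psi$. 2. For almost every $(t,x)\in(0,T)\times\mathbb{R}^D$, $f$ is differentiable at $(t,x)$ and $\partial_t f(t,x)-H(\nabla f(t,x))=0$. 3. There exists $c>0$ such that for every $t\in[0,T)$, the function $x\mapsto \frac{c}{2}|x|^2-f(t,x)$ is convex on $\mathbb{R}^D$. In addition, this unique function $f$ is the viscosity solution $g$ (restricted to $[0,T]\times\mathbb{R}^D$).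
   Context: $|\cdot|$ is the Euclidean norm on $\mathbb{R}^D$; $\nabla$ denotes the gradient in the space variable $x$ only, and $\nabla g(0,\cdot)=\nabla\psi$. "Almost every" refers to Lebesgue measure. Viscosity solution: a continuous function $g:[0,+\infty)\times\mathbb{R}^D\to\mathbb{R}$ with $g(0,\cdot)=\psi$ such that for every smooth $\phi:(0,+\infty)\times\mathbb{R}^D\to\mathbb{R}$ and every $(t,x)\in(0,+\infty)\times\mathbb{R}^D$: if $g-\phi$ has a local maximum at $(t,x)$ then $(\partial_t\phi-H(\nabla\phi))(t,x)\leq 0$, and if $g-\phi$ has a local minimum at $(t,x)$ then $(\partial_t\phi-H(\nabla\phi))(t,x)\geq 0$. "The viscosity solution" is the one that is Lipschitz (jointly in $(t,x)$); it exists and is unique in the class of Lipschitz functions. *)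

theory Defs
  imports "HOL-Analysis.Analysis"
begin

definition grad :: "('a::euclidean_space \<Rightarrow> real) \<Rightarrow> 'a \<Rightarrow> 'a" where
  "grad f x = (THE D. GDERIV f x :> D)"

lemma grad_eqI:
  assumes "GDERIV f x :> D"
  shows "grad f x = D"
  unfolding grad_def
proof (rule the_equality)
  fix D' assume "GDERIV f x :> D'"
  then have "(\<lambda>h. inner h D') = (\<lambda>h. inner h D)"
    using assms has_derivative_unique unfolding gderiv_def by blast
  then show "D' = D"
    by (metis inner_commute vector_eq_ldot)
qed (fact assms)

lemma GDERIV_grad:
  assumes "f differentiable (at x)"
  shows "GDERIV f x :> grad f x"
proof -
  obtain f' where f': "(f has_derivative f') (at x)"
    using assms unfolding differentiable_def by blast
  then have lin: "linear f'"
    by (rule has_derivative_linear)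
  define D where "D = (\<Sum>b\<in>Basis. f' b *\<^sub>R b)"
  have "f' h = inner h D" for h
  proof -
    have "f' h = f' (\<Sum>b\<in>Basis. inner h b *\<^sub>R b)"
      by (simp add: euclidean_representation)
    also have "\<dots> = (\<Sum>b\<in>Basis. inner h b * f' b)"
      using lin by (simp add: linear_sum linear_cmul)
    also have "\<dots> = inner h D"
      by (simp add: D_def inner_sum_right mult.commute)
    finally show ?thesis .
  qed
  then have "f' = (\<lambda>h. inner h D)"
    by blast
  then have "GDERIV f x :> D"
    using f' unfolding gderiv_def by simp
  then show ?thesis
    using grad_eqI by metis
qed

text \<open>For functions of a pair (time, space): the derivative in time and the gradient in space only.\<close>

definition dt :: "(real \<times> 'a::euclidean_space \<Rightarrow> real) \<Rightarrow> real \<times> 'a \<Rightarrow> real" where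
  "dt u = (\<lambda>(t, x). deriv (\<lambda>s. u (s, x)) t)"

definition grad_x :: "(real \<times> 'a::euclidean_space \<Rightarrow> real) \<Rightarrow> real \<times> 'a \<Rightarrow> 'a" where
  "grad_x u = (\<lambda>(t, x). grad (\<lambda>y. u (t, y)) x)"

text \<open>Continuous differentiability of order k, meant for an open set S. Derivatives of higher
  order are iterated directional derivatives, so that they remain scalar functions.\<close>

primrec Ck_on :: "nat \<Rightarrow> ('a::euclidean_space \<Rightarrow> real) \<Rightarrow> 'a set \<Rightarrow> bool" where
  "Ck_on 0 f S \<longleftrightarrow> continuous_on S f"
| "Ck_on (Suc k) f S \<longleftrightarrow>
     (\<forall>x\<in>S. f differentiable (at x)) \<and>
     (\<forall>v. Ck_on k (\<lambda>x. frechet_derivative f (at x) v) S)"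

definition smooth_fun_on :: "('a::euclidean_space \<Rightarrow> real) \<Rightarrow> 'a set \<Rightarrow> bool" where
  "smooth_fun_on f S \<longleftrightarrow> (\<forall>k. Ck_on k f S)"

definition lipschitz_fun_on :: "('a::metric_space \<Rightarrow> 'b::metric_space) \<Rightarrow> 'a set \<Rightarrow> bool" where
  "lipschitz_fun_on f S \<longleftrightarrow> (\<exists>K. K-lipschitz_on S f)"

definition local_max_at :: "('a::topological_space \<Rightarrow> real) \<Rightarrow> 'a \<Rightarrow> bool" where
  "local_max_at u p \<longleftrightarrow> (\<forall>\<^sub>F q in nhds p. u q \<le> u p)"

definition local_min_at :: "('a::topological_space \<Rightarrow> real) \<Rightarrow> 'a \<Rightarrow> bool" where
  "local_min_at u p \<longleftrightarrow> (\<forall>\<^sub>F q in nhds p. u p \<le> u q)"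

text \<open>Only the values of g at times t with t \<open>\<ge>\<close> 0 and of phi at times t with t > 0 matter: these
  are total functions standing for functions on the corresponding sets.\<close>

definition viscosity_solution ::
    "('a::euclidean_space \<Rightarrow> real) \<Rightarrow> ('a \<Rightarrow> real) \<Rightarrow> (real \<times> 'a \<Rightarrow> real) \<Rightarrow> bool" where
  "viscosity_solution H \<psi> g \<longleftrightarrow>
     continuous_on ({0..} \<times> UNIV) g \<and>
     (\<forall>x. g (0, x) = \<psi> x) \<and>
     (\<forall>\<phi>. smooth_fun_on \<phi> ({0<..} \<times> UNIV) \<longrightarrow>
       (\<forall>p\<in>{0<..} \<times> UNIV.
         (local_max_at (\<lambda>q. g q - \<phi> q) p \<longrightarrow> dt \<phi> p - H (grad_x \<phi> p) \<le> 0) \<and>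
         (local_min_at (\<lambda>q. g q - \<phi> q) p \<longrightarrow> dt \<phi> p - H (grad_x \<phi> p) \<ge> 0)))"

text \<open>Functions on \<open>[0,T] \<times> \<real>\<^sup>D\<close> are represented by extensional functions, so that equality of
  functions is equality on this set.\<close>

definition semiconcave_ae_solution ::
    "real \<Rightarrow> ('a::euclidean_space \<Rightarrow> real) \<Rightarrow> ('a \<Rightarrow> real) \<Rightarrow> (real \<times> 'a \<Rightarrow> real) \<Rightarrow> bool" where
  "semiconcave_ae_solution T H \<psi> f \<longleftrightarrow>
     f \<in> extensional ({0..T} \<times> UNIV) \<and>
     lipschitz_fun_on f ({0..T} \<times> UNIV) \<and>
     (\<forall>x. f (0, x) = \<psi> x) \<and>
     (AE p in lebesgue. p \<in> {0<..<T} \<times> UNIV \<longrightarrow>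
        f differentiable (at p) \<and> dt f p - H (grad_x f p) = 0) \<and>
     (\<exists>c>0. \<forall>t\<in>{0..<T}. convex_on UNIV (\<lambda>x. c / 2 * (norm x)\<^sup>2 - f (t, x)))"

end

theory Submission
  imports Defs
begin

text \<open>Uniqueness is a weak-strong argument. Let \<open>w = f - g\<close>, which is semiconcave in space. For any
  lower bound \<open>m\<close> of \<open>w(t, \<cdot>)\<close>, semiconcavity gives \<open>|Dw|\<^sup>2 \<le> C (w - m)\<close> at points of
  differentiability. Since \<open>|\<partial>\<^sub>t w| \<le> C |Dw|\<close>, the infimum of \<open>w(t, \<cdot>)\<close> over space does not
  decrease in time, so \<open>w \<ge> 0\<close>. Now \<open>m = 0\<close> is allowed, and expanding \<open>H\<close> at \<open>Dg\<close> gives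
  \<open>\<partial>\<^sub>t w \<le> \<nabla>H(Dg) \<bullet> Dw + C w\<close> almost everywhere, where \<open>\<nabla>H(Dg)\<close> is Lipschitz in space and
  1/2-Hoelder in time; so Gronwall's inequality for the supremum of \<open>w(t, \<cdot>)\<close> yields \<open>w \<le> 0\<close>.
  Both estimates are made over time steps \<open>\<delta>\<close>, with an error \<open>O(\<delta>\<^sup>3\<^sup>/\<^sup>2)\<close> per step, along
  straight lines avoiding the exceptional null set (Fubini).
  Conversely, testing with paraboloids shows that \<open>g\<close> solves the equation at every point of
  differentiability.\<close>

section \<open>Increments of Lipschitz functions with derivative bounds off a null set\<close>

text \<open>Subtracting a line of slope slightly above \<open>c\<close> leaves \<open>v\<close> with
  negative derivative off \<open>N\<close>. If \<open>v\<close> still rose, some level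
  \<open>y\<close> between \<open>v s\<close> and \<open>v t\<close> would be missed on
  \<open>N\<close>, because a Lipschitz image of a null set is null. At the last time with
  \<open>v\<close> at most \<open>y\<close> the value is \<open>y\<close> and \<open>v\<close>
  exceeds \<open>y\<close> right afterwards, contradicting the negative derivative.\<close>

lemma Lipschitz_increment_le:
  fixes u :: "real \<Rightarrow> real"
  assumes st: "s < t" and lip: "K-lipschitz_on {s..t} u" and N: "negligible N"
    and der: "\<And>\<tau>. \<tau> \<in> {s<..<t} - N \<Longrightarrow> \<exists>D\<le>c. (u has_real_derivative D) (at \<tau>)"
  shows "u t - u s \<le> c * (t - s)"
proof (rule field_le_epsilon)
  fix e :: real assume e: "e > 0"
  define e' where "e' = e / (t - s)"
  have e': "e' > 0" "e' * (t - s) = e" using e st by (auto simp: e'_def)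
  define v where "v = (\<lambda>\<tau>. u \<tau> - (c + e') * \<tau>)"
  have "(K + \<bar>c + e'\<bar>)-lipschitz_on {s..t} v"
    unfolding v_def using lip
    by (intro lipschitz_on_diff) (auto intro!: lipschitz_onI simp: dist_real_def abs_mult simp flip: right_diff_distrib)
  then obtain B where B: "B-lipschitz_on {s..t} v" by blast
  then have cont: "continuous_on {s..t} v" by (rule lipschitz_on_continuous_on)
  have "v t \<le> v s"
  proof (rule ccontr)
    assume "\<not> v t \<le> v s"
    then have less: "v s < v t" by simp
    have "negligible (v ` (N \<inter> {s..t}))"
    proof (rule negligible_locally_Lipschitz_image)
      show "negligible (N \<inter> {s..t})" using N by (rule negligible_Int[OF disjI1])
    next
      fix x assume "x \<in> N \<inter> {s..t}"
      then show "\<exists>T B. open T \<and> x \<in> T \<and> (\<forall>y\<in>N \<inter> {s..t} \<inter> T. norm (v y - v x) \<le> B * norm (y - x))"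
        using lipschitz_onD[OF B, of _ x] by (intro exI[of _ UNIV] exI[of _ B]) (auto simp: dist_norm)
    qed simp
    moreover have "\<not> negligible {v s<..<v t}"
      using less by (intro open_not_negligible) auto
    ultimately obtain y where y: "v s < y" "y < v t" "y \<notin> v ` (N \<inter> {s..t})"
      by (meson greaterThanLessThan_iff negligible_subset subsetI)
    define S where "S = {s..t} \<inter> v -` {..y}"
    have "compact S"
      unfolding S_def compact_eq_bounded_closed
      using cont continuous_on_closed_vimage[of "{s..t}" v] bounded_subset[OF bounded_closed_interval]
      by (auto simp: Int_commute)
    then obtain \<tau> where \<tau>: "\<tau> \<in> S" "\<And>r. r \<in> S \<Longrightarrow> r \<le> \<tau>"
      using compact_attains_sup[of S] y(1) st by (force simp: S_def)
    have above: "y < v r" if "\<tau> < r" "r \<le> t" for r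
      using \<tau>(2)[of r] that \<tau>(1) by (force simp: S_def)
    have "\<tau> < t" using \<tau>(1) y(2) by (cases "\<tau> = t") (auto simp: S_def)
    have "v \<tau> = y"
    proof (rule ccontr)
      assume "v \<tau> \<noteq> y"
      then have "v \<tau> < y" using \<tau>(1) by (auto simp: S_def)
      moreover have "continuous_on {\<tau>..t} v"
        using cont \<tau>(1) by (auto simp: S_def intro: continuous_on_subset)
      ultimately obtain r where "\<tau> \<le> r" "r \<le> t" "v r = y"
        using IVT'[of v \<tau> y t] y(2) \<open>\<tau> < t\<close> by auto
      then show False using above[of r] \<open>v \<tau> \<noteq> y\<close> by (cases "\<tau> = r") auto
    qed
    \<comment> \<open>\<open>v\<close> misses the value \<open>y\<close> on \<open>N\<close>, and
      \<open>v s < y\<close> excludes the left end point.\<close>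
    then have "\<tau> \<in> {s<..<t} - N"
      using \<tau>(1) y \<open>\<tau> < t\<close> by (cases "\<tau> = s") (auto simp: S_def)
    from der[OF this] obtain D where D: "D \<le> c" "(u has_real_derivative D) (at \<tau>)" by blast
    have "(v has_real_derivative D - (c + e')) (at \<tau>)"
      unfolding v_def by (rule derivative_eq_intros D refl | simp)+
    from DERIV_neg_dec_right[OF this] D(1) e' obtain d where
      d: "d > 0" "\<And>h. 0 < h \<Longrightarrow> h < d \<Longrightarrow> v (\<tau> + h) < v \<tau>" by auto
    define h where "h = min (d/2) (t - \<tau>)"
    have "0 < h" "h < d" "\<tau> + h \<le> t" using d(1) \<open>\<tau> < t\<close> by (auto simp: h_def)
    then show False using d(2)[of h] above[of "\<tau> + h"] \<open>v \<tau> = y\<close> by simp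
  qed
  then show "u t - u s \<le> c * (t - s) + e"
    using e' by (simp add: v_def algebra_simps)
qed

lemma negligible_iff_AE: "negligible S \<longleftrightarrow> (AE x in lebesgue. x \<notin> S)"
  by (auto simp: negligible_iff_null_sets eventually_ae_filter
      intro: null_sets_completion_subset)

text \<open>Fubini for null sets. Completion does not change almost-everywhere statements, so the
  claim can be moved to \<open>lborel\<close>, where the measure on pairs is the product
  measure.\<close>

lemma negligible_sections:
  fixes N :: "('a::euclidean_space \<times> 'b::euclidean_space) set"
  assumes "negligible N"
  shows "negligible {x. \<not> negligible {y. (x, y) \<in> N}}"
proof -
  have "AE p in lebesgue. p \<notin> N"
    using assms by (simp add: negligible_iff_AE)
  then have "AE p in (lborel \<Otimes>\<^sub>M lborel). p \<notin> N"
    unfolding AE_completion_iff lborel_prod .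
  then have "AE x in lborel. AE y in lborel. (x, y) \<notin> N"
    by (rule lborel_pair.AE_pair)
  then have "AE x in lebesgue. AE y in lebesgue. (x, y) \<notin> N"
    by (simp add: AE_completion_iff)
  then show ?thesis by (simp add: negligible_iff_AE)
qed

text \<open>The line ending at \<open>(t, x)\<close> may lie entirely inside \<open>N\<close>. By
  Fubini, for almost every \<open>y\<close> near \<open>x\<close> the parallel line ending at
  \<open>(t, y)\<close> meets \<open>N\<close> only at a null set of times, and there the
  one-dimensional estimate applies; \<open>w' (1, - v)\<close> is the derivative along the
  line.\<close>

lemma Lipschitz_increment_along_line:
  fixes w :: "real \<times> 'a::euclidean_space \<Rightarrow> real"
  assumes st: "s < t" and lip: "K-lipschitz_on ({s..t} \<times> UNIV) w"
    and N: "negligible N" and r: "r > 0"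
    and der: "\<And>\<tau> y. \<tau> \<in> {s<..<t} \<Longrightarrow> norm (y - x) < r \<Longrightarrow> (\<tau>, y + (t - \<tau>) *\<^sub>R v) \<notin> N \<Longrightarrow>
      \<exists>w'. (w has_derivative w') (at (\<tau>, y + (t - \<tau>) *\<^sub>R v)) \<and> w' (1, - v) \<le> c"
  shows "\<exists>y. norm (y - x) < r \<and> w (t, y) - w (s, y + (t - s) *\<^sub>R v) \<le> c * (t - s)"
proof -
  \<comment> \<open>This shear undoes the drift and swaps the coordinates, turning the lines into
    the sections of \<open>negligible_sections\<close>. Being Lipschitz, it keeps \<open>N\<close>
    null.\<close>
  define \<Psi> where "\<Psi> = (\<lambda>p::real \<times> 'a. (snd p - (t - fst p) *\<^sub>R v, fst p))"
  have neg: "negligible (\<Psi> ` N)"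
  proof (rule negligible_locally_Lipschitz_image)
    fix p assume "p \<in> N"
    have "norm (\<Psi> q - \<Psi> p) \<le> (2 + norm v) * norm (q - p)" for q
    proof -
      have "\<Psi> q - \<Psi> p = (snd (q - p) + fst (q - p) *\<^sub>R v, fst (q - p))"
        by (simp add: \<Psi>_def algebra_simps)
      also have "norm \<dots> \<le> norm (snd (q - p) + fst (q - p) *\<^sub>R v) + norm (fst (q - p))"
        by (rule norm_Pair_le)
      also have "\<dots> \<le> norm (snd (q - p)) + norm (fst (q - p)) * norm v + norm (fst (q - p))"
        by (intro add_right_mono norm_triangle_le) simp
      also have "\<dots> \<le> norm (q - p) + norm (q - p) * norm v + norm (q - p)"
        using norm_fst_le[of "fst (q - p)" "snd (q - p)"] norm_snd_le[of "snd (q - p)" "fst (q - p)"]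
        unfolding prod.collapse by (intro add_mono mult_right_mono norm_ge_zero)
      finally show ?thesis by (simp add: algebra_simps)
    qed
    then show "\<exists>T B. open T \<and> p \<in> T \<and> (\<forall>q\<in>N \<inter> T. norm (\<Psi> q - \<Psi> p) \<le> B * norm (q - p))"
      by (intro exI[of _ UNIV] exI[of _ "2 + norm v"]) auto
  qed (use N in auto)
  have "\<not> negligible (ball x r)"
    using r by (intro open_not_negligible) auto
  with negligible_sections[OF neg] obtain y
    where y: "norm (y - x) < r" and sec: "negligible {\<tau>. (y, \<tau>) \<in> \<Psi> ` N}"
    by (metis (no_types, lifting) dist_commute dist_norm mem_Collect_eq mem_ball negligible_subset subsetI)
  define u where "u = (\<lambda>\<tau>. w (\<tau>, y + (t - \<tau>) *\<^sub>R v))"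
  have "u t - u s \<le> c * (t - s)"
  proof (rule Lipschitz_increment_le[OF st _ sec])
    show "(K * (1 + norm v))-lipschitz_on {s..t} u"
    proof (rule lipschitz_onI)
      fix a b assume ab: "a \<in> {s..t}" "b \<in> {s..t}"
      have "dist (u a) (u b) \<le> K * dist (a, y + (t - a) *\<^sub>R v) (b, y + (t - b) *\<^sub>R v)"
        unfolding u_def using ab by (intro lipschitz_onD[OF lip]) auto
      also have "\<dots> \<le> K * (norm (a - b) + norm (a - b) * norm v)"
      proof (rule mult_left_mono)
        have "dist (a, y + (t - a) *\<^sub>R v) (b, y + (t - b) *\<^sub>R v) = norm (a - b, - ((a - b) *\<^sub>R v))"
          by (simp add: dist_norm algebra_simps)
        also have "\<dots> \<le> norm (a - b) + norm (- ((a - b) *\<^sub>R v))" by (rule norm_Pair_le)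
        finally show "dist (a, y + (t - a) *\<^sub>R v) (b, y + (t - b) *\<^sub>R v) \<le> norm (a - b) + norm (a - b) * norm v"
          by simp
      qed (rule lipschitz_on_nonneg[OF lip])
      finally show "dist (u a) (u b) \<le> K * (1 + norm v) * dist a b"
        by (simp add: dist_norm algebra_simps)
    qed (use lipschitz_on_nonneg[OF lip] in auto)
  next
    fix \<tau> assume \<tau>: "\<tau> \<in> {s<..<t} - {\<tau>. (y, \<tau>) \<in> \<Psi> ` N}"
    have "(y, \<tau>) = \<Psi> (\<tau>, y + (t - \<tau>) *\<^sub>R v)" by (simp add: \<Psi>_def)
    with \<tau> have "(\<tau>, y + (t - \<tau>) *\<^sub>R v) \<notin> N" by blast
    with der y \<tau> obtain w' where
      w': "(w has_derivative w') (at (\<tau>, y + (t - \<tau>) *\<^sub>R v))" "w' (1, - v) \<le> c" by blast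
    have "((\<lambda>\<tau>. (\<tau>, y + (t - \<tau>) *\<^sub>R v)) has_derivative (\<lambda>h. (h, - (h *\<^sub>R v)))) (at \<tau>)"
      by (auto intro!: derivative_eq_intros)
    from has_derivative_compose[OF this w'(1)]
    have "(u has_derivative (\<lambda>h. w' (h, - (h *\<^sub>R v)))) (at \<tau>)" by (simp add: u_def)
    moreover have "w' (h, - (h *\<^sub>R v)) = w' (1, - v) * h" for h
      using linear_scale[OF has_derivative_linear[OF w'(1)], of h "(1, - v)"] by simp
    ultimately have "(u has_real_derivative w' (1, - v)) (at \<tau>)"
      by (simp add: has_field_derivative_def)
    then show "\<exists>D\<le>c. (u has_real_derivative D) (at \<tau>)" using w'(2) by blast
  qed
  then show ?thesis using y by (auto simp: u_def)
qed

section \<open>A discrete Gronwall inequality\<close>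

text \<open>With \<open>n\<close> equal steps of length \<open>t0 / n\<close>, the \<open>n\<close>
  errors of order 3/2 in the step length add up to at most a constant times
  \<open>sqrt (t0 / n)\<close>, amplified by no more than \<open>exp (C * t0)\<close>. This vanishes
  as \<open>n\<close> grows.\<close>

lemma discrete_Gronwall:
  fixes a :: "real \<Rightarrow> real"
  assumes t0: "t0 > 0" and C: "C \<ge> 0" and E: "E \<ge> 0" and a0: "a 0 \<le> 0"
    and step: "\<And>s t. 0 \<le> s \<Longrightarrow> s < t \<Longrightarrow> t \<le> t0 \<Longrightarrow>
      a t \<le> (1 + C * (t - s)) * a s + E * (t - s) * sqrt (t - s)"
  shows "a t0 \<le> 0"
proof -
  have bound: "a t0 \<le> E * t0 * exp (C * t0) * sqrt (t0 / real n)" if n: "n > 0" for n :: nat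
  proof -
    define \<delta> where "\<delta> = t0 / real n"
    have \<delta>: "\<delta> > 0" "real n * \<delta> = t0" using t0 n by (auto simp: \<delta>_def)
    have "a (real k * \<delta>) \<le> E * real k * \<delta> * sqrt \<delta> * (1 + C * \<delta>) ^ k" if "k \<le> n" for k
      using that
    proof (induction k)
      case 0 then show ?case using a0 by simp
    next
      case (Suc k)
      have "real (Suc k) * \<delta> \<le> real n * \<delta>" using Suc.prems \<delta> by (intro mult_right_mono) auto
      then have "a (real (Suc k) * \<delta>) \<le> (1 + C * (real (Suc k) * \<delta> - real k * \<delta>)) * a (real k * \<delta>)
          + E * (real (Suc k) * \<delta> - real k * \<delta>) * sqrt (real (Suc k) * \<delta> - real k * \<delta>)"
        using \<delta> by (intro step) (auto simp: algebra_simps)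
      also have "\<dots> = (1 + C * \<delta>) * a (real k * \<delta>) + E * \<delta> * sqrt \<delta> * 1"
        by (simp add: algebra_simps)
      \<comment> \<open>The newest error is enlarged by a power of \<open>1 + C * \<delta>\<close>,
        which is at least 1, so that both summands carry the same factor.\<close>
      also have "\<dots> \<le> (1 + C * \<delta>) * (E * real k * \<delta> * sqrt \<delta> * (1 + C * \<delta>) ^ k)
          + E * \<delta> * sqrt \<delta> * (1 + C * \<delta>) ^ Suc k"
        using Suc C E \<delta> by (intro add_mono mult_left_mono one_le_power) auto
      also have "\<dots> = E * real (Suc k) * \<delta> * sqrt \<delta> * (1 + C * \<delta>) ^ Suc k"
        by (simp add: algebra_simps)
      finally show ?case .
    qed
    from this[of n] have "a t0 \<le> E * t0 * sqrt \<delta> * (1 + C * \<delta>) ^ n"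
      using \<delta> by (simp add: mult.assoc)
    also have "\<dots> \<le> E * t0 * sqrt \<delta> * exp (C * t0)"
    proof (rule mult_left_mono)
      have "(1 + C * \<delta>) ^ n \<le> exp (C * \<delta>) ^ n"
        using C \<delta> by (intro power_mono exp_ge_add_one_self) auto
      also have "\<dots> = exp (C * t0)" using \<delta> by (simp add: exp_of_nat_mult[symmetric] algebra_simps)
      finally show "(1 + C * \<delta>) ^ n \<le> exp (C * t0)" .
    qed (use E t0 \<delta> in auto)
    finally show ?thesis by (simp add: \<delta>_def algebra_simps)
  qed
  have "(\<lambda>n. E * t0 * exp (C * t0) * sqrt (t0 / real n)) \<longlonglongrightarrow> E * t0 * exp (C * t0) * sqrt 0"
    by (intro tendsto_intros tendsto_divide_0[OF tendsto_const] filterlim_real_at_infinity_sequentially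
        filterlim_at_top_imp_at_infinity filterlim_real_sequentially)
  then have "a t0 \<le> E * t0 * exp (C * t0) * sqrt 0"
    by (rule LIMSEQ_le_const) (auto intro!: exI[of _ 1] bound)
  then show ?thesis by simp
qed

section \<open>Gradients, convexity and Taylor estimates\<close>

text \<open>Composing the joint derivative with the embeddings of the time axis and of the space
  slice identifies its two components; linearity reassembles them. This is the link between Frechet
  derivatives of pairs and the description terms \<open>dt\<close> and
  \<open>grad_x\<close>.\<close>

lemma has_derivative_dt_grad_x:
  assumes f: "(f has_derivative f') (at (t, x))"
  shows "f' = (\<lambda>q. q \<bullet> (dt f (t, x), grad_x f (t, x)))"
    and "GDERIV (\<lambda>y. f (t, y)) x :> grad_x f (t, x)"
proof -
  have "((\<lambda>s. (s, x)) has_derivative (\<lambda>a. (a, 0))) (at t)"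
    by (auto intro!: derivative_eq_intros)
  from has_derivative_compose[OF this f]
  have ft: "((\<lambda>s. f (s, x)) has_derivative (\<lambda>a. f' (a, 0))) (at t)" .
  have lin: "linear f'" using f by (rule has_derivative_linear)
  define c where "c = f' (1, 0)"
  have scale: "f' (a, 0) = c * a" for a
    using linear_scale[OF lin, of a "(1, 0)"] by (simp add: c_def)
  have dt: "dt f (t, x) = c"
    using ft by (simp add: scale has_field_derivative_def dt_def DERIV_imp_deriv)
  have "((\<lambda>y. (t, y)) has_derivative (\<lambda>h. (0, h))) (at x)"
    by (auto intro!: derivative_eq_intros)
  from has_derivative_compose[OF this f]
  have fx: "((\<lambda>y. f (t, y)) has_derivative (\<lambda>h. f' (0, h))) (at x)" .
  then have "(\<lambda>y. f (t, y)) differentiable (at x)" by (auto simp: differentiable_def)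
  then show G: "GDERIV (\<lambda>y. f (t, y)) x :> grad_x f (t, x)"
    using GDERIV_grad by (simp add: grad_x_def)
  with fx have "(\<lambda>h. f' (0, h)) = (\<lambda>h. h \<bullet> grad_x f (t, x))"
    unfolding gderiv_def by (rule has_derivative_unique)
  then have space: "f' (0, h) = h \<bullet> grad_x f (t, x)" for h by meson
  show "f' = (\<lambda>q. q \<bullet> (dt f (t, x), grad_x f (t, x)))"
  proof
    fix q
    have "f' q = f' (fst q, 0) + f' (0, snd q)"
      using linear_add[OF lin, of "(fst q, 0)" "(0, snd q)"] by simp
    also have "\<dots> = q \<bullet> (dt f (t, x), grad_x f (t, x))"
      by (simp add: scale space dt inner_prod_def)
    finally show "f' q = q \<bullet> (dt f (t, x), grad_x f (t, x))" .
  qed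
qed

lemma GDERIV_line:
  assumes "GDERIV u (x + s *\<^sub>R h) :> D"
  shows "((\<lambda>s. u (x + s *\<^sub>R h)) has_real_derivative h \<bullet> D) (at s)"
proof -
  have "((\<lambda>s. x + s *\<^sub>R h) has_derivative (\<lambda>a. a *\<^sub>R h)) (at s)"
    by (auto intro!: derivative_eq_intros)
  from has_derivative_compose[OF this assms[unfolded gderiv_def]]
  show ?thesis unfolding has_field_derivative_def
    by (rule has_derivative_eq_rhs) (simp add: fun_eq_iff)
qed

text \<open>The derivative in the direction \<open>D\<close> itself is \<open>|D|^2\<close>, while
  the difference quotients in that direction are at most \<open>K * |D|\<close>.\<close>

lemma GDERIV_norm_le_Lipschitz:
  assumes "GDERIV u x :> D" and "K-lipschitz_on UNIV u"
  shows "norm D \<le> K"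
proof -
  have "((\<lambda>s. u (x + s *\<^sub>R D)) has_real_derivative D \<bullet> D) (at 0)"
    using assms(1) by (intro GDERIV_line) simp
  then have "((\<lambda>h. norm ((u (x + h *\<^sub>R D) - u x) / h)) \<longlongrightarrow> norm (D \<bullet> D)) (at 0)"
    unfolding DERIV_def by (intro tendsto_norm) simp
  moreover have "\<forall>\<^sub>F h in at 0. norm ((u (x + h *\<^sub>R D) - u x) / h) \<le> K * norm D"
  proof (rule always_eventually, rule allI)
    fix h :: real
    have "\<bar>u (x + h *\<^sub>R D) - u x\<bar> \<le> K * norm D * \<bar>h\<bar>"
      using lipschitz_onD[OF assms(2), of "x + h *\<^sub>R D" x]
      by (simp add: dist_norm mult.assoc mult.commute[of "norm D"])
    then show "norm ((u (x + h *\<^sub>R D) - u x) / h) \<le> K * norm D"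
      using lipschitz_on_nonneg[OF assms(2)]
      by (cases "h = 0") (simp_all add: pos_divide_le_eq)
  qed
  ultimately have "norm (D \<bullet> D) \<le> K * norm D"
    by (rule tendsto_upperbound) simp
  then have "norm D * norm D \<le> K * norm D"
    by (simp add: power2_norm_eq_inner[symmetric] power2_eq_square)
  then show ?thesis
    using lipschitz_on_nonneg[OF assms(2)] by (cases "D = 0") auto
qed

text \<open>The restriction to the line through \<open>x\<close> and \<open>y\<close> is convex in
  one variable, where the tangent inequality is known.\<close>

lemma convex_on_above_gradient:
  assumes "convex_on UNIV u" and "GDERIV u x :> D"
  shows "u x + (y - x) \<bullet> D \<le> u y"
proof -
  define \<phi> where "\<phi> = (\<lambda>s. u (x + s *\<^sub>R (y - x)))"
  have "convex_on UNIV \<phi>"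
  proof (rule convex_onI)
    fix t a b :: real assume "0 < t" "t < 1"
    have "\<phi> ((1 - t) *\<^sub>R a + t *\<^sub>R b) = u ((1 - t) *\<^sub>R (x + a *\<^sub>R (y - x)) + t *\<^sub>R (x + b *\<^sub>R (y - x)))"
      unfolding \<phi>_def by (rule arg_cong[where f = u]) (simp add: algebra_simps)
    also have "\<dots> \<le> (1 - t) * \<phi> a + t * \<phi> b"
      unfolding \<phi>_def using \<open>0 < t\<close> \<open>t < 1\<close> by (intro convex_onD[OF assms(1)]) auto
    finally show "\<phi> ((1 - t) *\<^sub>R a + t *\<^sub>R b) \<le> (1 - t) * \<phi> a + t * \<phi> b" .
  qed simp
  moreover have "(\<phi> has_real_derivative (y - x) \<bullet> D) (at 0)"
    unfolding \<phi>_def using assms(2) by (intro GDERIV_line) simp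
  ultimately have "(y - x) \<bullet> D * (1 - 0) \<le> \<phi> 1 - \<phi> 0"
    by (intro convex_on_imp_above_tangent[where A = UNIV]) auto
  then show ?thesis by (simp add: \<phi>_def)
qed

text \<open>Monotonicity of \<open>G\<close> makes the derivative along every line
  nondecreasing.\<close>

lemma convex_on_monotone_gradient:
  assumes G: "\<And>x. GDERIV u x :> G x" and mono: "\<And>x y. (x - y) \<bullet> (G x - G y) \<ge> 0"
  shows "convex_on UNIV u"
proof (rule convex_onI)
  fix t :: real and x y assume t: "0 < t" "t < 1"
  define \<phi> where "\<phi> = (\<lambda>s. u (x + s *\<^sub>R (y - x)))"
  have "convex_on UNIV \<phi>"
  proof (rule convex_on_realI)
    show "(\<phi> has_real_derivative (y - x) \<bullet> G (x + s *\<^sub>R (y - x))) (at s)" for s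
      unfolding \<phi>_def by (intro GDERIV_line G)
    show "(y - x) \<bullet> G (x + a *\<^sub>R (y - x)) \<le> (y - x) \<bullet> G (x + b *\<^sub>R (y - x))" if "a \<le> b" for a b
    proof (cases "a = b")
      case False
      have "x + b *\<^sub>R (y - x) - (x + a *\<^sub>R (y - x)) = (b - a) *\<^sub>R (y - x)"
        by (simp add: algebra_simps)
      then have "0 \<le> (b - a) * ((y - x) \<bullet> (G (x + b *\<^sub>R (y - x)) - G (x + a *\<^sub>R (y - x))))"
        using mono[of "x + b *\<^sub>R (y - x)" "x + a *\<^sub>R (y - x)"] by simp
      then show ?thesis using False that by (simp add: zero_le_mult_iff inner_diff_right)
    qed simp
  qed simp
  from convex_onD[OF this, of t 0 1] t have "\<phi> t \<le> (1 - t) * \<phi> 0 + t * \<phi> 1" by simp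
  moreover have "x + t *\<^sub>R (y - x) = (1 - t) *\<^sub>R x + t *\<^sub>R y" by (simp add: algebra_simps)
  ultimately show "u ((1 - t) *\<^sub>R x + t *\<^sub>R y) \<le> (1 - t) * u x + t * u y"
    by (simp add: \<phi>_def)
qed simp

text \<open>The mean value theorem on the segment yields the gradient at an intermediate point,
  which differs from \<open>G x\<close> by at most \<open>L * |y - x|\<close>. Using an intermediate
  point instead of an integral costs the factor 1/2 in the constant.\<close>

lemma Lipschitz_gradient_Taylor:
  assumes S: "convex S" "x \<in> S" "y \<in> S" and G: "\<And>z. z \<in> S \<Longrightarrow> GDERIV u z :> G z"
    and L: "\<And>z. z \<in> S \<Longrightarrow> norm (G z - G x) \<le> L * norm (z - x)"
  shows "\<bar>u y - u x - (y - x) \<bullet> G x\<bar> \<le> L * (norm (y - x))\<^sup>2"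
proof -
  have seg: "x + s *\<^sub>R (y - x) \<in> S" if "0 \<le> s" "s \<le> 1" for s
    using convexD_alt[OF S that] by (simp add: algebra_simps)
  have "((\<lambda>s. u (x + s *\<^sub>R (y - x))) has_derivative (\<lambda>a. ((y - x) \<bullet> G (x + s *\<^sub>R (y - x))) * a)) (at s within {0..1})"
    if "0 \<le> s" "s \<le> 1" for s
    using GDERIV_line[OF G[OF seg[OF that]]] unfolding has_field_derivative_def
    by (rule has_derivative_at_withinI)
  then obtain s where s: "s \<in> {0<..<1}"
    and eq: "u (x + 1 *\<^sub>R (y - x)) - u (x + 0 *\<^sub>R (y - x)) = ((y - x) \<bullet> G (x + s *\<^sub>R (y - x))) * (1 - 0)"
    using mvt_simple[of 0 1 "\<lambda>s. u (x + s *\<^sub>R (y - x))" "\<lambda>s a. ((y - x) \<bullet> G (x + s *\<^sub>R (y - x))) * a"]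
    by (metis zero_less_one)
  have L0: "0 \<le> L * norm (y - x)" using order_trans[OF norm_ge_zero L[OF S(3)]] .
  have "\<bar>u y - u x - (y - x) \<bullet> G x\<bar> = \<bar>(y - x) \<bullet> (G (x + s *\<^sub>R (y - x)) - G x)\<bar>"
    using eq by (simp add: inner_diff_right)
  also have "\<dots> \<le> norm (y - x) * norm (G (x + s *\<^sub>R (y - x)) - G x)"
    by (rule Cauchy_Schwarz_ineq2)
  also have "\<dots> \<le> norm (y - x) * (L * norm (y - x))"
  proof (rule mult_left_mono)
    have "norm (G (x + s *\<^sub>R (y - x)) - G x) \<le> s * (L * norm (y - x))"
      using L[OF seg[of s]] s by (simp add: mult_ac)
    also have "\<dots> \<le> 1 * (L * norm (y - x))" using s L0 by (intro mult_right_mono) auto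
    finally show "norm (G (x + s *\<^sub>R (y - x)) - G x) \<le> L * norm (y - x)" by simp
  qed simp
  finally show ?thesis by (simp add: power2_eq_square mult_ac)
qed

text \<open>Moving from \<open>x\<close> to the minimiser \<open>x - D / (2 C)\<close> of the
  majorising paraboloid lowers \<open>u\<close> by at least \<open>|D|^2 / (4 C)\<close>, yet
  \<open>u\<close> cannot drop below \<open>m\<close>.\<close>

lemma semiconcave_gradient_bound:
  fixes u :: "'a::real_inner \<Rightarrow> real"
  assumes C: "C > 0" and upper: "\<And>y. u y \<le> u x + (y - x) \<bullet> D + C * (norm (y - x))\<^sup>2"
    and m: "\<And>y. m \<le> u y"
  shows "(norm D)\<^sup>2 \<le> 4 * C * (u x - m)"
proof -
  have "m \<le> u (x - (1 / (2 * C)) *\<^sub>R D)" by (rule m)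
  also have "\<dots> \<le> u x - (norm D)\<^sup>2 / (2 * C) + C * (norm D / (2 * C))\<^sup>2"
    using upper[of "x - (1 / (2 * C)) *\<^sub>R D"] C by (simp add: power2_norm_eq_inner)
  also have "\<dots> = u x - (norm D)\<^sup>2 / (4 * C)"
    using C by (simp add: field_simps power2_eq_square)
  finally show ?thesis using C by (simp add: field_simps)
qed

text \<open>The difference \<open>u - v\<close> is bounded below by \<open>- M\<close> and lies
  below paraboloids of constant \<open>2 * L\<close>, so the preceding gradient bound applies with a
  gap of at most \<open>2 * M\<close>. It later converts Lipschitz continuity of \<open>g\<close> in
  time into a modulus of continuity in time for its spatial gradient.\<close>

lemma gradient_interpolation:
  fixes u v :: "'a::euclidean_space \<Rightarrow> real"
  assumes L: "L > 0" and Gu: "\<And>x. GDERIV u x :> Gu x" and Gv: "\<And>x. GDERIV v x :> Gv x"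
    and Lu: "\<And>x y. norm (Gu x - Gu y) \<le> L * norm (x - y)"
    and Lv: "\<And>x y. norm (Gv x - Gv y) \<le> L * norm (x - y)"
    and M: "\<And>x. \<bar>u x - v x\<bar> \<le> M"
  shows "norm (Gu x - Gv x) \<le> 4 * sqrt (L * M)"
proof -
  have "(norm (Gu x - Gv x))\<^sup>2 \<le> 4 * (2 * L) * ((u x - v x) - - M)"
  proof (rule semiconcave_gradient_bound[where u = "\<lambda>x. u x - v x"])
    fix y
    show "- M \<le> u y - v y" using M[of y] by simp
    have "\<bar>u y - u x - (y - x) \<bullet> Gu x\<bar> \<le> L * (norm (y - x))\<^sup>2"
      using Gu Lu by (intro Lipschitz_gradient_Taylor[where S = UNIV]) auto
    moreover have "\<bar>v y - v x - (y - x) \<bullet> Gv x\<bar> \<le> L * (norm (y - x))\<^sup>2"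
      using Gv Lv by (intro Lipschitz_gradient_Taylor[where S = UNIV]) auto
    ultimately show "u y - v y \<le> u x - v x + (y - x) \<bullet> (Gu x - Gv x) + 2 * L * (norm (y - x))\<^sup>2"
      by (simp add: inner_diff_right)
  qed (use L in auto)
  also have "\<dots> \<le> 4 * (2 * L) * (2 * M)"
    using M[of x] L by (intro mult_left_mono) auto
  finally have "norm (Gu x - Gv x) \<le> sqrt (4\<^sup>2 * (L * M))"
    by (intro real_le_rsqrt) simp
  then show ?thesis by (simp add: real_sqrt_mult)
qed

text \<open>On a compact ball the second derivatives are bounded, so each directional derivative
  \<open>F v\<close> is Lipschitz there by the mean value inequality. Summing over basis directions
  controls the gradient.\<close>

lemma C2_gradient_Lipschitz:
  fixes H :: "'a::euclidean_space \<Rightarrow> real"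
  assumes "Ck_on 2 H UNIV"
  shows "GDERIV H x :> grad H x"
    and "\<exists>C\<ge>0. \<forall>p\<in>cball 0 K. \<forall>q\<in>cball 0 K. norm (grad H p - grad H q) \<le> C * norm (p - q)"
proof -
  define F where "F = (\<lambda>v x. frechet_derivative H (at x) v)"
  have C2: "\<forall>x. H differentiable (at x)" "\<forall>v x. F v differentiable (at x)"
    "\<forall>v h. continuous_on UNIV (\<lambda>x. frechet_derivative (F v) (at x) h)"
    using assms unfolding numeral_2_eq_2 Ck_on.simps F_def by simp_all
  show G: "GDERIV H x :> grad H x" for x using C2(1) by (intro GDERIV_grad) simp
  have F_eq: "F v x = v \<bullet> grad H x" for v x
    using fun_cong[OF frechet_derivative_at[OF G[of x, unfolded gderiv_def]], of v] by (simp add: F_def)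
  have "\<exists>B\<ge>0. \<forall>p\<in>cball 0 K. \<forall>q\<in>cball 0 K. \<bar>F v p - F v q\<bar> \<le> B * norm (p - q)" for v
  proof -
    have "\<exists>B. \<forall>x\<in>cball 0 K. \<bar>frechet_derivative (F v) (at x) b\<bar> \<le> B" for b
    proof -
      have "compact ((\<lambda>x. frechet_derivative (F v) (at x) b) ` cball 0 K)"
        by (intro compact_continuous_image continuous_on_subset[OF C2(3)[rule_format]]) auto
      then show ?thesis by (auto dest!: compact_imp_bounded simp: bounded_iff)
    qed
    then obtain B where B: "\<And>b x. x \<in> cball 0 K \<Longrightarrow> \<bar>frechet_derivative (F v) (at x) b\<bar> \<le> B b"
      by metis
    have "\<bar>F v p - F v q\<bar> \<le> \<bar>sum B Basis\<bar> * norm (p - q)" if "p \<in> cball 0 K" "q \<in> cball 0 K" for p q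
    proof -
      have "norm (F v p - F v q) \<le> \<bar>sum B Basis\<bar> * norm (p - q)"
      proof (rule differentiable_bound[where S = "cball 0 K" and f' = "\<lambda>x. frechet_derivative (F v) (at x)"])
        fix x :: 'a assume x: "x \<in> cball 0 K"
        have der: "(F v has_derivative frechet_derivative (F v) (at x)) (at x)"
          using C2(2) frechet_derivative_works by blast
        then show "(F v has_derivative frechet_derivative (F v) (at x)) (at x within cball 0 K)"
          by (rule has_derivative_at_withinI)
        have "onorm (frechet_derivative (F v) (at x)) \<le> (\<Sum>b\<in>Basis. norm (frechet_derivative (F v) (at x) b))"
          by (intro onorm_componentwise has_derivative_bounded_linear[OF der])
        also have "\<dots> \<le> sum B Basis" using B[OF x] by (intro sum_mono) auto
        finally show "onorm (frechet_derivative (F v) (at x)) \<le> \<bar>sum B Basis\<bar>" by simp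
      qed (use that in auto)
      then show ?thesis by simp
    qed
    then show ?thesis by (intro exI[of _ "\<bar>sum B Basis\<bar>"]) auto
  qed
  then obtain B where B0: "\<And>v. B v \<ge> 0"
    and B: "\<And>v p q. p \<in> cball 0 K \<Longrightarrow> q \<in> cball 0 K \<Longrightarrow> \<bar>F v p - F v q\<bar> \<le> B v * norm (p - q)"
    by metis
  have "norm (grad H p - grad H q) \<le> sum B Basis * norm (p - q)"
    if "p \<in> cball 0 K" "q \<in> cball 0 K" for p q
  proof -
    have "norm (grad H p - grad H q) \<le> (\<Sum>b\<in>Basis. \<bar>(grad H p - grad H q) \<bullet> b\<bar>)"
      by (rule norm_le_l1)
    also have "\<dots> = (\<Sum>b\<in>Basis. \<bar>F b p - F b q\<bar>)"
      by (intro sum.cong) (simp_all add: F_eq inner_diff_right inner_commute[of "grad H p - grad H q"])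
    also have "\<dots> \<le> (\<Sum>b\<in>Basis. B b * norm (p - q))"
      using B[OF that] by (intro sum_mono)
    finally show ?thesis by (simp add: sum_distrib_right)
  qed
  then show "\<exists>C\<ge>0. \<forall>p\<in>cball 0 K. \<forall>q\<in>cball 0 K. norm (grad H p - grad H q) \<le> C * norm (p - q)"
    using B0 by (intro exI[of _ "sum B Basis"]) (auto intro: sum_nonneg)
qed

section \<open>Viscosity solutions at points of differentiability\<close>

text \<open>The family is closed under directional derivatives: the direction \<open>v\<close> turns
  the coefficients \<open>a\<close>, \<open>b\<close>, \<open>K\<close> into
  \<open>v \<bullet> b\<close>, \<open>(2 * K) *\<^sub>R v\<close>, 0. Hence the induction runs over
  all coefficients at once.\<close>

lemma Ck_on_quadratic:
  fixes b :: "'a::euclidean_space"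
  shows "Ck_on k (\<lambda>q. a + q \<bullet> b + K * (q \<bullet> q)) S"
proof (induction k arbitrary: a b K)
  case 0
  show ?case by (auto intro!: continuous_intros)
next
  case (Suc k)
  have der: "((\<lambda>q. a + q \<bullet> b + K * (q \<bullet> q)) has_derivative (\<lambda>v. v \<bullet> b + q \<bullet> ((2 * K) *\<^sub>R v))) (at q)" for q
    by (auto intro!: derivative_eq_intros simp: inner_commute algebra_simps)
  have "frechet_derivative (\<lambda>q. a + q \<bullet> b + K * (q \<bullet> q)) (at q) v = v \<bullet> b + q \<bullet> ((2 * K) *\<^sub>R v) + 0 * (q \<bullet> q)"
    for q v using fun_cong[OF frechet_derivative_at[OF der[of q]], of v] by simp
  then have "Ck_on k (\<lambda>q. frechet_derivative (\<lambda>q. a + q \<bullet> b + K * (q \<bullet> q)) (at q) v) S" for v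
    using Suc[of "v \<bullet> b" "(2 * K) *\<^sub>R v" 0] by simp
  moreover have "(\<lambda>q. a + q \<bullet> b + K * (q \<bullet> q)) differentiable (at q)" for q
    using der differentiable_def by blast
  ultimately show ?case by simp
qed

text \<open>A function merely differentiable at \<open>p\<close> need not be touched from above
  there by any smooth function. The touching point is therefore allowed to move to a nearby
  \<open>q\<close>, at the price of an error \<open>e\<close> in the gradient: a steep enough
  paraboloid forces the maximum over a small closed ball into its interior.\<close>

lemma approximate_touching_paraboloid:
  fixes u :: "'a::euclidean_space \<Rightarrow> real"
  assumes der: "(u has_derivative (\<lambda>h. h \<bullet> D)) (at p)" and cont: "continuous_on (ball p R) u"
    and R: "R > 0" and e: "e > 0"
  shows "\<exists>q\<in>ball p R. \<exists>K. local_max_at (\<lambda>z. u z - (z \<bullet> D + K * (norm (z - p))\<^sup>2)) q \<and>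
    norm ((2 * K) *\<^sub>R (q - p)) \<le> e"
proof -
  obtain d where d: "d > 0" "\<And>z. norm (z - p) < d \<Longrightarrow> \<bar>u z - u p - (z - p) \<bullet> D\<bar> \<le> e / 4 * norm (z - p)"
    using der e unfolding has_derivative_at_alt real_norm_def by (metis divide_pos_pos zero_less_numeral)
  define r where "r = min (d / 2) (R / 2)"
  have r: "r > 0" "r < d" "r < R" using d R by (auto simp: r_def)
  \<comment> \<open>On the sphere of radius \<open>r\<close> the penalty is
    \<open>e * r / 2\<close>, which beats the tangent error \<open>e * r / 4\<close>, while the
    gradient \<open>2 * K * r\<close> of the penalty is exactly \<open>e\<close>.\<close>
  define K where "K = e / (2 * r)"
  define v where "v = (\<lambda>z. u z - (z \<bullet> D + K * (norm (z - p))\<^sup>2))"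
  have "continuous_on (cball p r) v"
    unfolding v_def using r by (auto intro!: continuous_intros intro: continuous_on_subset[OF cont])
  then obtain q where q: "q \<in> cball p r" and max: "\<And>z. z \<in> cball p r \<Longrightarrow> v z \<le> v q"
    using continuous_attains_sup[of "cball p r" v] r by auto
  have "norm (q - p) \<noteq> r"
  proof
    assume eq: "norm (q - p) = r"
    have "v q - v p \<le> e / 4 * r - K * r\<^sup>2"
      using abs_le_D1[OF d(2)[of q]] eq r by (simp add: v_def algebra_simps)
    also have "\<dots> = - (e * r / 4)"
      using r by (simp add: K_def field_simps power2_eq_square)
    also have "\<dots> < 0" using e r by simp
    finally show False using max[of p] r by simp
  qed
  then have qr: "q \<in> ball p r" using q by (simp add: dist_norm norm_minus_commute)
  have "\<forall>\<^sub>F z in nhds q. z \<in> ball p r" using qr by (intro eventually_nhds_in_open) auto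
  then have "local_max_at v q"
    unfolding local_max_at_def by (rule eventually_mono) (auto intro: max)
  moreover have "norm ((2 * K) *\<^sub>R (q - p)) \<le> e"
  proof -
    have "norm ((2 * K) *\<^sub>R (q - p)) = 2 * K * norm (q - p)" using e r by (simp add: K_def)
    also have "\<dots> \<le> 2 * K * r"
      using qr e r by (intro mult_left_mono) (auto simp: K_def dist_norm norm_minus_commute)
    also have "\<dots> = e" using r by (simp add: K_def)
    finally show ?thesis .
  qed
  ultimately show ?thesis
    using qr r by (intro bexI[of _ q] exI[of _ K]) (auto simp: v_def)
qed

text \<open>If the equation failed at \<open>D\<close>, continuity of \<open>H\<close> would make it
  fail with the same sign for all gradients within some \<open>e\<close> of \<open>D\<close>. A
  paraboloid touching \<open>g\<close> near \<open>p\<close> has such a gradient at its touching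
  point, against the viscosity inequality there.\<close>

lemma viscosity_solution_classical:
  fixes H :: "'a::euclidean_space \<Rightarrow> real"
  assumes visc: "viscosity_solution H \<psi> g" and H: "continuous_on UNIV H"
    and t: "t > 0" and diff: "g differentiable (at (t, x))"
  shows "dt g (t, x) = H (grad_x g (t, x))"
proof -
  define p where "p = (t, x)"
  define D where "D = (dt g p, grad_x g p)"
  define F where "F = (\<lambda>D :: real \<times> 'a. fst D - H (snd D))"
  have gD: "(g has_derivative (\<lambda>h. h \<bullet> D)) (at p)"
    using diff has_derivative_dt_grad_x(1) by (auto simp: differentiable_def p_def D_def)
  \<comment> \<open>Radius \<open>t\<close> keeps the ball at positive times, where the test
    inequalities are available.\<close>
  have sub: "ball p t \<subseteq> {0<..} \<times> UNIV"
  proof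
    fix q assume "q \<in> ball p t"
    then have "dist t (fst q) < t"
      using dist_fst_le[of p q] by (simp add: p_def)
    then show "q \<in> {0<..} \<times> UNIV" by (cases q) (auto simp: dist_real_def)
  qed
  have cont: "continuous_on (ball p t) g"
  proof (rule continuous_on_subset)
    show "continuous_on ({0..} \<times> UNIV) g" using visc by (simp add: viscosity_solution_def)
    show "ball p t \<subseteq> {0..} \<times> UNIV" using sub by (auto simp: subset_eq less_imp_le)
  qed
  have test: "dt \<phi> q - H (grad_x \<phi> q) = F (D + (2 * K) *\<^sub>R (q - p))" "smooth_fun_on \<phi> S"
    if "\<phi> = (\<lambda>z. z \<bullet> D + K * (norm (z - p))\<^sup>2)" for \<phi> K q S
  proof -
    have \<phi>: "\<phi> = (\<lambda>z. K * (p \<bullet> p) + z \<bullet> (D - (2 * K) *\<^sub>R p) + K * (z \<bullet> z))"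
      by (auto simp: that power2_norm_eq_inner algebra_simps inner_commute)
    then show "smooth_fun_on \<phi> S" using Ck_on_quadratic by (auto simp: smooth_fun_on_def)
    have "(\<phi> has_derivative (\<lambda>h. h \<bullet> (D + (2 * K) *\<^sub>R (q - p)))) (at q)"
      unfolding \<phi> by (auto intro!: derivative_eq_intros simp: inner_commute algebra_simps)
    then have "(\<phi> has_derivative (\<lambda>h. h \<bullet> (D + (2 * K) *\<^sub>R (q - p)))) (at (fst q, snd q))" by simp
    from has_derivative_dt_grad_x(1)[OF this]
    have "D + (2 * K) *\<^sub>R (q - p) = (dt \<phi> q, grad_x \<phi> q)"
      by (metis prod.collapse inner_commute vector_eq_ldot)
    then show "dt \<phi> q - H (grad_x \<phi> q) = F (D + (2 * K) *\<^sub>R (q - p))"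
      by (simp add: F_def)
  qed
  have sol: "(local_max_at (\<lambda>z. g z - \<phi> z) q \<longrightarrow> dt \<phi> q - H (grad_x \<phi> q) \<le> 0) \<and>
      (local_min_at (\<lambda>z. g z - \<phi> z) q \<longrightarrow> dt \<phi> q - H (grad_x \<phi> q) \<ge> 0)"
    if "q \<in> ball p t" "smooth_fun_on \<phi> ({0<..} \<times> UNIV)" for \<phi> q
    using visc sub that unfolding viscosity_solution_def by blast
  have "isCont (\<lambda>D. H (snd D)) D"
    by (rule isCont_o2[OF continuous_snd[OF continuous_ident]])
      (use H in \<open>simp add: continuous_on_eq_continuous_at\<close>)
  then have "isCont F D"
    unfolding F_def by (rule continuous_diff[OF continuous_fst[OF continuous_ident]])
  have lim: "\<exists>e>0. \<forall>D'. norm (D' - D) \<le> e \<longrightarrow> \<bar>F D' - F D\<bar> < \<epsilon>" if \<epsilon>: "\<epsilon> > 0" for \<epsilon>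
  proof -
    obtain d where d: "d > 0" "\<And>D'. dist D' D < d \<Longrightarrow> dist (F D') (F D) < \<epsilon>"
      using \<open>isCont F D\<close>[unfolded continuous_at_eps_delta, rule_format, OF \<epsilon>] by metis
    have "\<bar>F D' - F D\<bar> < \<epsilon>" if "norm (D' - D) \<le> d / 2" for D'
      using d(2)[of D'] d(1) that by (simp add: dist_norm)
    then show ?thesis using d(1) by (intro exI[of _ "d / 2"]) simp
  qed
  have "F D \<le> 0"
  proof (rule ccontr)
    assume "\<not> F D \<le> 0"
    with lim[of "F D"] obtain e where e: "e > 0"
      and "\<forall>D'. norm (D' - D) \<le> e \<longrightarrow> \<bar>F D' - F D\<bar> < F D" by auto
    then have pos: "F D' > 0" if "norm (D' - D) \<le> e" for D'
      using that by (smt (verit))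
    obtain q K where q: "q \<in> ball p t" "norm ((2 * K) *\<^sub>R (q - p)) \<le> e"
      "local_max_at (\<lambda>z. g z - (z \<bullet> D + K * (norm (z - p))\<^sup>2)) q"
      using approximate_touching_paraboloid[OF gD cont t e] by blast
    have "F (D + (2 * K) *\<^sub>R (q - p)) \<le> 0"
      using sol[OF q(1) test(2)[OF refl]] q(3) by (simp only: test(1)[OF refl])
    then show False using pos[of "D + (2 * K) *\<^sub>R (q - p)"] q(2) by simp
  qed
  moreover have "F D \<ge> 0"
  proof (rule ccontr)
    assume "\<not> F D \<ge> 0"
    with lim[of "- F D"] obtain e where e: "e > 0"
      and "\<forall>D'. norm (D' - D) \<le> e \<longrightarrow> \<bar>F D' - F D\<bar> < - F D" by auto
    then have neg: "F D' < 0" if "norm (D' - D) \<le> e" for D'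
      using that by (smt (verit))
    \<comment> \<open>Touching \<open>g\<close> from below is touching \<open>- g\<close> from
      above; negation flips the signs of \<open>D\<close> and \<open>K\<close> in the
      paraboloid.\<close>
    have "((\<lambda>z. - g z) has_derivative (\<lambda>h. h \<bullet> (- D))) (at p)"
      using has_derivative_minus[OF gD] by simp
    then obtain q K where q: "q \<in> ball p t" "norm ((2 * K) *\<^sub>R (q - p)) \<le> e"
      and max: "local_max_at (\<lambda>z. - g z - (z \<bullet> (- D) + K * (norm (z - p))\<^sup>2)) q"
      using approximate_touching_paraboloid[OF _ continuous_on_minus[OF cont] t e] by blast
    from max have min: "local_min_at (\<lambda>z. g z - (z \<bullet> D + (- K) * (norm (z - p))\<^sup>2)) q"
      unfolding local_max_at_def local_min_at_def by (rule eventually_mono) simp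
    have "F (D + (2 * (- K)) *\<^sub>R (q - p)) \<ge> 0"
      using sol[OF q(1) test(2)[OF refl]] min by (simp only: test(1)[OF refl])
    then show False using neg[of "D + (2 * (- K)) *\<^sub>R (q - p)"] q(2) by simp
  qed
  ultimately show ?thesis by (simp add: F_def D_def p_def)
qed

section \<open>Growth in time of a supremum over space\<close>

text \<open>The supremum need not be attained, so a near-maximiser \<open>x\<close> at time
  \<open>t\<close> is followed back along a line to time \<open>s\<close>, where the value is at
  most the supremum. The velocity may depend on \<open>x\<close>; the slope is requested on a tube
  around the line because Fubini only provides a good line ending near \<open>x\<close>.\<close>

lemma SUP_increment_le:
  fixes u :: "real \<times> 'a::euclidean_space \<Rightarrow> real"
  assumes st: "s < t" and lip: "K-lipschitz_on ({s..t} \<times> UNIV) u" and N: "negligible N"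
    and bdd: "bdd_above (range (\<lambda>x. u (s, x)))"
    and slope: "\<And>x. (SUP x. u (t, x)) - (t - s) \<le> u (t, x) \<Longrightarrow>
      \<exists>v. \<forall>\<tau>\<in>{s<..<t}. \<forall>y. norm (y - x) < t - s \<longrightarrow> (\<tau>, y + (t - \<tau>) *\<^sub>R v) \<notin> N \<longrightarrow>
        (\<exists>u'. (u has_derivative u') (at (\<tau>, y + (t - \<tau>) *\<^sub>R v)) \<and> u' (1, - v) \<le> c)"
  shows "(SUP x. u (t, x)) \<le> (SUP x. u (s, x)) + c * (t - s)"
proof (rule field_le_epsilon)
  fix e :: real assume e: "e > 0"
  have K: "K \<ge> 0" using lip by (rule lipschitz_on_nonneg)
  \<comment> \<open>The first bound makes \<open>x\<close> admissible for \<open>slope\<close> and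
    keeps \<open>y\<close> inside the tube. The second pays for near-maximality, \<open>r\<close>,
    and for moving from \<open>x\<close> to \<open>y\<close>, \<open>K * r\<close>.\<close>
  define r where "r = min (t - s) (e / (K + 1))"
  have r: "r > 0" "r \<le> t - s" using e K st by (auto simp: r_def)
  have "r \<le> e / (K + 1)" by (simp add: r_def)
  then have re: "(K + 1) * r \<le> e" using K by (simp add: pos_le_divide_eq mult.commute)
  obtain x where x: "(SUP x. u (t, x)) - r < u (t, x)"
    using less_cSupD[of "range (\<lambda>x. u (t, x))" "(SUP x. u (t, x)) - r"] r(1) by auto
  then have "(SUP x. u (t, x)) - (t - s) \<le> u (t, x)" using r(2) by simp
  from slope[OF this] obtain v where v: "\<forall>\<tau>\<in>{s<..<t}. \<forall>y. norm (y - x) < t - s \<longrightarrow>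
      (\<tau>, y + (t - \<tau>) *\<^sub>R v) \<notin> N \<longrightarrow>
      (\<exists>u'. (u has_derivative u') (at (\<tau>, y + (t - \<tau>) *\<^sub>R v)) \<and> u' (1, - v) \<le> c)" ..
  have "\<exists>y. norm (y - x) < r \<and> u (t, y) - u (s, y + (t - s) *\<^sub>R v) \<le> c * (t - s)"
    using r by (intro Lipschitz_increment_along_line[OF st lip N] v[rule_format]) auto
  then obtain y where y: "norm (y - x) < r" "u (t, y) - u (s, y + (t - s) *\<^sub>R v) \<le> c * (t - s)"
    by blast
  have "u (t, x) - u (t, y) \<le> K * dist (t, x) (t, y)"
    using lipschitz_onD[OF lip, of "(t, x)" "(t, y)"] st by (simp add: dist_real_def abs_le_iff)
  also have "\<dots> \<le> K * r"
    using y(1) K by (intro mult_left_mono) (auto simp: dist_Pair_Pair dist_norm norm_minus_commute)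
  finally have "u (t, x) \<le> u (t, y) + K * r" by simp
  moreover have "u (s, y + (t - s) *\<^sub>R v) \<le> (SUP x. u (s, x))"
    using bdd by (rule cSUP_upper[OF UNIV_I])
  ultimately show "(SUP x. u (t, x)) \<le> (SUP x. u (s, x)) + c * (t - s) + e"
    using x y(2) re by (simp add: algebra_simps)
qed

section \<open>Comparison of a semiconcave solution with a regular one\<close>

text \<open>Here \<open>f\<close> is the almost-everywhere solution and \<open>g\<close> the regular
  one. The common Lipschitz constant \<open>K\<close> confines their spatial gradients to
  \<open>cball 0 K\<close>, so \<open>H\<close> is controlled only there, with a single constant
  \<open>A\<close> for the size of its gradient and for the variation of it. The semiconcavity
  constant \<open>C\<close> stands for \<open>c / 2\<close>.\<close>

locale weak_strong_pair =
  fixes H :: "'a::euclidean_space \<Rightarrow> real" and f g :: "real \<times> 'a \<Rightarrow> real"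
    and T K L A C :: real and N :: "(real \<times> 'a) set"
  assumes T: "T > 0" and L: "L > 0" and A: "A \<ge> 0" and C: "C > 0"
    and f_lip: "K-lipschitz_on ({0..T} \<times> UNIV) f"
    and g_lip: "K-lipschitz_on ({0..T} \<times> UNIV) g"
    and init: "f (0, x) = g (0, x)"
    and N: "negligible N"
    and f_eq: "t \<in> {0<..<T} \<Longrightarrow> (t, x) \<notin> N \<Longrightarrow>
      f differentiable (at (t, x)) \<and> dt f (t, x) = H (grad_x f (t, x))"
    and g_eq: "t \<in> {0<..<T} \<Longrightarrow>
      g differentiable (at (t, x)) \<and> dt g (t, x) = H (grad_x g (t, x))"
    and f_semiconcave: "t \<in> {0<..<T} \<Longrightarrow> convex_on UNIV (\<lambda>x. C * (norm x)\<^sup>2 - f (t, x))"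
    and g_grad: "t \<in> {0..<T} \<Longrightarrow> GDERIV (\<lambda>x. g (t, x)) x :> grad_x g (t, x)"
    and g_grad_lip: "t \<in> {0..<T} \<Longrightarrow> norm (grad_x g (t, x) - grad_x g (t, y)) \<le> L * norm (x - y)"
    and H_grad: "GDERIV H p :> grad H p"
    and H_grad_bound: "p \<in> cball 0 K \<Longrightarrow> norm (grad H p) \<le> A"
    and H_grad_lip: "p \<in> cball 0 K \<Longrightarrow> q \<in> cball 0 K \<Longrightarrow> norm (grad H p - grad H q) \<le> A * norm (p - q)"
begin

definition w :: "real \<times> 'a \<Rightarrow> real" where "w p = f p - g p"

lemma K_nonneg: "K \<ge> 0"
  using f_lip by (rule lipschitz_on_nonneg)

lemma w_lip: "(K + K)-lipschitz_on ({0..T} \<times> UNIV) w"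
  unfolding w_def[abs_def] using f_lip g_lip by (rule lipschitz_on_diff)

lemma w_dist: "t \<in> {0..T} \<Longrightarrow> s \<in> {0..T} \<Longrightarrow> \<bar>w (t, x) - w (s, y)\<bar> \<le> 2 * K * (\<bar>t - s\<bar> + norm (x - y))"
  using lipschitz_onD[OF w_lip, of "(t, x)" "(s, y)"]
    mult_left_mono[OF norm_Pair_le[of "t - s" "x - y"], of "2 * K"] K_nonneg
  by (simp add: dist_norm)

lemma w_bounded: "t \<in> {0..T} \<Longrightarrow> \<bar>w (t, x)\<bar> \<le> 2 * K * T"
  using w_dist[of t 0 x x] mult_left_mono[of t T "2 * K"] init K_nonneg T by (simp add: w_def)

lemma bdd_w: "t \<in> {0..T} \<Longrightarrow> bdd_above (range (\<lambda>x. w (t, x)))"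
  "t \<in> {0..T} \<Longrightarrow> bdd_above (range (\<lambda>x. - w (t, x)))"
  using w_bounded[of t] by (auto intro!: bdd_aboveI[of _ "2 * K * T"] simp: abs_le_iff)

lemma grad_x_g_in_cball: "t \<in> {0..<T} \<Longrightarrow> grad_x g (t, x) \<in> cball 0 K"
proof -
  assume t: "t \<in> {0..<T}"
  have "K-lipschitz_on UNIV (\<lambda>x. g (t, x))"
    using lipschitz_onD[OF g_lip, of "(t, _)" "(t, _)"] t K_nonneg
    by (intro lipschitz_onI) (auto simp: dist_Pair_Pair)
  from GDERIV_norm_le_Lipschitz[OF g_grad[OF t] this] show ?thesis by simp
qed

lemma H_Lipschitz:
  assumes "p \<in> cball 0 K" "q \<in> cball 0 K"
  shows "\<bar>H p - H q\<bar> \<le> A * norm (p - q)"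
proof -
  have "norm (H p - H q) \<le> A * norm (p - q)"
  proof (rule differentiable_bound[where S = "cball 0 K" and f' = "\<lambda>x h. h \<bullet> grad H x"])
    fix x :: 'a assume x: "x \<in> cball 0 K"
    show "(H has_derivative (\<lambda>h. h \<bullet> grad H x)) (at x within cball 0 K)"
      using H_grad unfolding gderiv_def by (rule has_derivative_at_withinI)
    show "onorm (\<lambda>h. h \<bullet> grad H x) \<le> A"
    proof (rule onorm_le)
      fix h
      have "norm (h \<bullet> grad H x) \<le> norm h * norm (grad H x)"
        by (simp add: Cauchy_Schwarz_ineq2)
      also have "\<dots> \<le> norm h * A" using H_grad_bound[OF x] by (intro mult_left_mono) auto
      finally show "norm (h \<bullet> grad H x) \<le> A * norm h" by (simp add: mult.commute)
    qed
  qed (use assms in auto)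
  then show ?thesis by simp
qed

lemma H_Taylor:
  assumes "p \<in> cball 0 K" "q \<in> cball 0 K"
  shows "H p - H q \<le> (p - q) \<bullet> grad H q + A * (norm (p - q))\<^sup>2"
  using Lipschitz_gradient_Taylor[of "cball 0 K" q p H "grad H" A] assms H_grad H_grad_lip
  by (auto simp: abs_le_iff)

definition Dw :: "real \<times> 'a \<Rightarrow> 'a" where "Dw p = grad_x f p - grad_x g p"

text \<open>Collects what both estimates use off \<open>N\<close>. Subtracting the two equations
  gives the time derivative of \<open>w\<close>. Semiconcavity of \<open>f\<close> and the Taylor
  bound for \<open>g\<close> put \<open>w\<close> under a paraboloid of constant
  \<open>C + L\<close>, which yields the gradient bound.\<close>

lemma good_point:
  assumes t: "t \<in> {0<..<T}" and p: "(t, x) \<notin> N"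
  shows "grad_x f (t, x) \<in> cball 0 K"
    and "(w has_derivative (\<lambda>q. q \<bullet> (H (grad_x f (t, x)) - H (grad_x g (t, x)), Dw (t, x)))) (at (t, x))"
    and "(\<And>y. m \<le> w (t, y)) \<Longrightarrow> (norm (Dw (t, x)))\<^sup>2 \<le> 4 * (C + L) * (w (t, x) - m)"
proof -
  obtain f' where f': "(f has_derivative f') (at (t, x))"
    using f_eq[of t x] t p by (auto simp: differentiable_def)
  obtain g' where g': "(g has_derivative g') (at (t, x))"
    using g_eq[of t x] t by (auto simp: differentiable_def)
  have eq: "dt f (t, x) = H (grad_x f (t, x))" "dt g (t, x) = H (grad_x g (t, x))"
    using f_eq[of t x] g_eq[of t x] t p by auto
  note fG = has_derivative_dt_grad_x(2)[OF f'] and gG = has_derivative_dt_grad_x(2)[OF g']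
  have "K-lipschitz_on UNIV (\<lambda>x. f (t, x))"
    using lipschitz_onD[OF f_lip, of "(t, _)" "(t, _)"] t K_nonneg
    by (intro lipschitz_onI) (auto simp: dist_Pair_Pair)
  from GDERIV_norm_le_Lipschitz[OF fG this] show "grad_x f (t, x) \<in> cball 0 K" by simp
  have "(w has_derivative (\<lambda>q. f' q - g' q)) (at (t, x))"
    unfolding w_def[abs_def] using f' g' by (rule has_derivative_diff)
  then show "(w has_derivative (\<lambda>q. q \<bullet> (H (grad_x f (t, x)) - H (grad_x g (t, x)), Dw (t, x)))) (at (t, x))"
    unfolding has_derivative_dt_grad_x(1)[OF f'] has_derivative_dt_grad_x(1)[OF g'] eq
    by (simp add: Dw_def flip: inner_diff_right)
  assume m: "\<And>y. m \<le> w (t, y)"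
  show "(norm (Dw (t, x)))\<^sup>2 \<le> 4 * (C + L) * (w (t, x) - m)"
  proof (rule semiconcave_gradient_bound[where u = "\<lambda>y. w (t, y)"])
    fix y
    have "((\<lambda>x. C * (x \<bullet> x) - f (t, x)) has_derivative (\<lambda>h. h \<bullet> ((2 * C) *\<^sub>R x - grad_x f (t, x)))) (at x)"
      using fG unfolding gderiv_def
      by (auto intro!: derivative_eq_intros simp: inner_commute algebra_simps)
    then have "GDERIV (\<lambda>x. C * (norm x)\<^sup>2 - f (t, x)) x :> (2 * C) *\<^sub>R x - grad_x f (t, x)"
      by (simp add: gderiv_def power2_norm_eq_inner)
    from convex_on_above_gradient[OF f_semiconcave[OF t] this, of y]
    have "f (t, y) \<le> f (t, x) + (y - x) \<bullet> grad_x f (t, x) + C * (norm (y - x))\<^sup>2"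
      by (simp add: power2_norm_eq_inner algebra_simps inner_commute)
    moreover have "\<bar>g (t, y) - g (t, x) - (y - x) \<bullet> grad_x g (t, x)\<bar> \<le> L * (norm (y - x))\<^sup>2"
      using t g_grad[of t] g_grad_lip[of t]
      by (intro Lipschitz_gradient_Taylor[where S = UNIV and G = "\<lambda>x. grad_x g (t, x)"]) auto
    ultimately show "w (t, y) \<le> w (t, x) + (y - x) \<bullet> Dw (t, x) + (C + L) * (norm (y - x))\<^sup>2"
      by (simp add: w_def Dw_def inner_diff_right distrib_right abs_le_iff)
  qed (use m C L in auto)
qed

text \<open>Two time slices of \<open>g\<close> differ by at most \<open>K * |t - s|\<close>, and
  both have \<open>L\<close>-Lipschitz gradients, so interpolation applies.\<close>

lemma grad_x_g_Hoelder:
  assumes "s \<in> {0..<T}" "t \<in> {0..<T}"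
  shows "norm (grad_x g (t, x) - grad_x g (s, x)) \<le> 4 * sqrt (L * (K * \<bar>t - s\<bar>))"
proof (rule gradient_interpolation[where u = "\<lambda>x. g (t, x)" and v = "\<lambda>x. g (s, x)" and Gu = "\<lambda>x. grad_x g (t, x)" and Gv = "\<lambda>x. grad_x g (s, x)"])
  show "\<bar>g (t, x) - g (s, x)\<bar> \<le> K * \<bar>t - s\<bar>" for x
    using lipschitz_onD[OF g_lip, of "(t, x)" "(s, x)"] assms by (simp add: dist_Pair_Pair dist_real_def)
qed (use assms L g_grad g_grad_lip in auto)

text \<open>Applied to \<open>- w\<close> with lines at rest in space. Close to a near-minimiser,
  \<open>w\<close> exceeds its infimum by \<open>O(\<delta>)\<close>, so \<open>|Dw|\<close>, and
  with it the time derivative of \<open>w\<close>, is of order \<open>sqrt \<delta>\<close>.\<close>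

lemma w_nonneg:
  assumes t: "t \<in> {0<..T}"
  shows "0 \<le> w (t, x)"
proof -
  define a where "a = (\<lambda>t. SUP x. - w (t, x))"
  \<comment> \<open>The factor \<open>6 * K + 1\<close> bounds the gap above the lower bound in
    units of \<open>\<delta>\<close>: 1 for near-minimality, \<open>4 * K\<close> for the
    displacement in time and space, \<open>2 * K\<close> for carrying the lower bound from time
    \<open>t'\<close> to \<open>\<tau>\<close>.\<close>
  define E where "E = A * sqrt (4 * (C + L) * (6 * K + 1))"
  have upper: "- w (t, x) \<le> a t" if "t \<in> {0..T}" for t x
    unfolding a_def using bdd_w(2)[OF that] by (rule cSUP_upper[OF UNIV_I])
  have "a t \<le> 0"
  proof (rule discrete_Gronwall[where a = a and ?t0.0 = t and C = 0 and E = E])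
    show "a 0 \<le> 0" by (simp add: a_def w_def init)
    fix s t' assume st: "0 \<le> s" "s < t'" "t' \<le> t"
    define \<delta> where "\<delta> = t' - s"
    have range: "s \<in> {0..T}" "t' \<in> {0..T}" "\<delta> > 0" using st t by (auto simp: \<delta>_def)
    have "a t' \<le> a s + (E * sqrt \<delta>) * (t' - s)"
      unfolding a_def
    proof (rule SUP_increment_le[where u = "\<lambda>p. - w p" and N = N])
      show "(K + K)-lipschitz_on ({s..t'} \<times> UNIV) (\<lambda>p. - w p)"
        using w_lip range by (intro lipschitz_on_minus lipschitz_on_subset[OF w_lip]) auto
      show "bdd_above (range (\<lambda>x. - w (s, x)))" using range by (intro bdd_w)
    next
      fix x assume "(SUP x. - w (t', x)) - (t' - s) \<le> - w (t', x)"
      then have x: "w (t', x) \<le> - a t' + \<delta>" by (simp add: a_def \<delta>_def)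
      have "\<exists>u'. ((\<lambda>p. - w p) has_derivative u') (at (\<tau>, y)) \<and> u' (1, - 0) \<le> E * sqrt \<delta>"
        if \<tau>: "\<tau> \<in> {s<..<t'}" and y: "norm (y - x) < \<delta>" and good: "(\<tau>, y) \<notin> N" for \<tau> y
      proof -
        have \<tau>T: "\<tau> \<in> {0<..<T}" "\<tau> \<in> {0..T}" "\<bar>\<tau> - t'\<bar> \<le> \<delta>" using \<tau> st t by (auto simp: \<delta>_def)
        note gp = good_point[OF \<tau>T(1) good]
        have "- a t' - 2 * K * \<delta> \<le> w (\<tau>, z)" for z
          using w_dist[OF \<tau>T(2) range(2), of z z] upper[OF range(2), of z]
            mult_left_mono[OF \<tau>T(3), of "2 * K"] K_nonneg by (simp add: abs_le_iff)
        from gp(3)[OF this]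
        have Dw_le: "(norm (Dw (\<tau>, y)))\<^sup>2 \<le> 4 * (C + L) * (w (\<tau>, y) - (- a t' - 2 * K * \<delta>))" .
        have "\<bar>\<tau> - t'\<bar> + norm (y - x) \<le> \<delta> + \<delta>" using y \<tau>T(3) by simp
        from mult_left_mono[OF this, of "2 * K"]
        have "w (\<tau>, y) \<le> w (t', x) + 2 * K * (\<delta> + \<delta>)"
          using w_dist[OF \<tau>T(2) range(2), of y x] K_nonneg by (simp add: abs_le_iff)
        then have "4 * (C + L) * (w (\<tau>, y) - (- a t' - 2 * K * \<delta>)) \<le> 4 * (C + L) * ((6 * K + 1) * \<delta>)"
          using x C L by (intro mult_left_mono) (auto simp: algebra_simps)
        from order_trans[OF Dw_le this] have "norm (Dw (\<tau>, y)) \<le> sqrt (4 * (C + L) * (6 * K + 1) * \<delta>)"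
          by (intro real_le_rsqrt) (simp add: mult.assoc)
        then have "A * norm (Dw (\<tau>, y)) \<le> E * sqrt \<delta>"
          using mult_left_mono[OF _ A] by (simp add: E_def real_sqrt_mult mult.assoc)
        moreover have "H (grad_x g (\<tau>, y)) - H (grad_x f (\<tau>, y)) \<le> A * norm (Dw (\<tau>, y))"
          using H_Lipschitz[OF gp(1) grad_x_g_in_cball[of \<tau> y]] \<tau>T(1) by (simp add: Dw_def abs_le_iff)
        ultimately show ?thesis
          by (intro exI[of _ "\<lambda>q. - (q \<bullet> (H (grad_x f (\<tau>, y)) - H (grad_x g (\<tau>, y)), Dw (\<tau>, y)))"] conjI
              has_derivative_minus gp(2)) simp
      qed
      then show "\<exists>v. \<forall>\<tau>\<in>{s<..<t'}. \<forall>y. norm (y - x) < t' - s \<longrightarrow> (\<tau>, y + (t' - \<tau>) *\<^sub>R v) \<notin> N \<longrightarrow>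
        (\<exists>u'. ((\<lambda>p. - w p) has_derivative u') (at (\<tau>, y + (t' - \<tau>) *\<^sub>R v)) \<and> u' (1, - v) \<le> E * sqrt \<delta>)"
        by (intro exI[of _ 0]) (auto simp: \<delta>_def)
    qed (use st N in auto)
    then show "a t' \<le> (1 + 0 * (t' - s)) * a s + E * (t' - s) * sqrt (t' - s)"
      by (simp add: \<delta>_def mult_ac)
  qed (use t A C L K_nonneg in \<open>auto simp: E_def\<close>)
  then show ?thesis using upper[of t x] t by auto
qed

text \<open>Now \<open>0 \<le> w\<close> and semiconcavity give \<open>|Dw|\<^sup>2 \<le> 4 (C + L) w\<close>, which absorbs the quadratic
  remainder of \<open>H\<close> at \<open>Dg\<close>; the linear term is transport along \<open>\<nabla>H(Dg)\<close>, frozen at one point on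
  each short time interval.\<close>

lemma w_nonpos:
  assumes t: "t \<in> {0<..T}"
  shows "w (t, x) \<le> 0"
proof -
  define a where "a = (\<lambda>t. SUP x. w (t, x))"
  define B where "B = 4 * (C + L) * A"
  \<comment> \<open>The first summand is the bound \<open>2 * K\<close> on \<open>|Dw|\<close> times
    the error from freezing the velocity; the second comes from replacing \<open>w\<close> at time
    \<open>\<tau>\<close> by the supremum at time \<open>s\<close> in the quadratic term.\<close>
  define E where "E = 2 * K * (A * (L * (1 + A) * sqrt T + 4 * sqrt (L * K))) + B * (2 * K * sqrt T)"
  have B: "B \<ge> 0" using A C L by (simp add: B_def)
  have upper: "w (t, x) \<le> a t" if "t \<in> {0..T}" for t x
    unfolding a_def using bdd_w(1)[OF that] by (rule cSUP_upper[OF UNIV_I])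
  have "a t \<le> 0"
  proof (rule discrete_Gronwall[where a = a and ?t0.0 = t and C = B and E = E])
    show "a 0 \<le> 0" by (simp add: a_def w_def init)
    fix s t' assume st: "0 \<le> s" "s < t'" "t' \<le> t"
    define \<delta> where "\<delta> = t' - s"
    have range: "s \<in> {0..T}" "s \<in> {0..<T}" "t' \<in> {0..T}" "\<delta> > 0" using st t by (auto simp: \<delta>_def)
    \<comment> \<open>Lets errors of order \<open>\<delta>\<close> be absorbed into those of order
      \<open>sqrt \<delta>\<close>.\<close>
    have \<delta>_le: "\<delta> \<le> sqrt T * sqrt \<delta>"
    proof -
      have "sqrt \<delta> * sqrt \<delta> \<le> sqrt T * sqrt \<delta>"
        using range st t by (intro mult_right_mono) (auto simp: \<delta>_def)
      then show ?thesis using range by simp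
    qed
    have "a t' \<le> a s + (B * a s + E * sqrt \<delta>) * (t' - s)"
      unfolding a_def
    proof (rule SUP_increment_le[where u = w and N = N])
      show "(K + K)-lipschitz_on ({s..t'} \<times> UNIV) w"
        using range by (intro lipschitz_on_subset[OF w_lip]) auto
      show "bdd_above (range (\<lambda>x. w (s, x)))" using range by (intro bdd_w)
    next
      fix x
      define v where "v = grad H (grad_x g (s, x))"
      have v: "norm v \<le> A"
        unfolding v_def by (intro H_grad_bound grad_x_g_in_cball range)
      have "\<exists>u'. (w has_derivative u') (at (\<tau>, y + (t' - \<tau>) *\<^sub>R v)) \<and> u' (1, - v) \<le> B * a s + E * sqrt \<delta>"
        if \<tau>: "\<tau> \<in> {s<..<t'}" and y: "norm (y - x) < \<delta>" and good: "(\<tau>, y + (t' - \<tau>) *\<^sub>R v) \<notin> N" for \<tau> y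
      proof -
        define z where "z = y + (t' - \<tau>) *\<^sub>R v"
        have \<tau>T: "\<tau> \<in> {0<..<T}" "\<tau> \<in> {0..T}" "\<tau> \<in> {0..<T}" "\<bar>\<tau> - s\<bar> \<le> \<delta>" "\<bar>t' - \<tau>\<bar> \<le> \<delta>"
          using \<tau> st t by (auto simp: \<delta>_def)
        note gp = good_point[OF \<tau>T(1) good, folded z_def]
        note gK = grad_x_g_in_cball[OF \<tau>T(3), of z]
        have "norm (z - x) \<le> norm (y - x) + \<bar>t' - \<tau>\<bar> * norm v"
          using norm_triangle_ineq[of "y - x" "(t' - \<tau>) *\<^sub>R v"] by (simp add: z_def diff_add_eq)
        also have "\<dots> \<le> \<delta> + \<delta> * A"
          using y v \<tau>T(5) range by (intro add_mono mult_mono) auto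
        finally have zx: "norm (z - x) \<le> \<delta> * (1 + A)" by (simp add: algebra_simps)
        have "norm (grad_x g (\<tau>, z) - grad_x g (s, x))
            \<le> norm (grad_x g (\<tau>, z) - grad_x g (\<tau>, x)) + norm (grad_x g (\<tau>, x) - grad_x g (s, x))"
          by (rule norm_diff_triangle_le[OF order_refl order_refl])
        also have "\<dots> \<le> L * (\<delta> * (1 + A)) + 4 * sqrt (L * (K * \<delta>))"
        proof (rule add_mono)
          show "norm (grad_x g (\<tau>, z) - grad_x g (\<tau>, x)) \<le> L * (\<delta> * (1 + A))"
            using g_grad_lip[OF \<tau>T(3), of z x] mult_left_mono[OF zx, of L] L by linarith
          have "sqrt (L * (K * \<bar>\<tau> - s\<bar>)) \<le> sqrt (L * (K * \<delta>))"
            using \<tau>T(4) L K_nonneg by (intro real_sqrt_le_mono mult_left_mono) auto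
          then show "norm (grad_x g (\<tau>, x) - grad_x g (s, x)) \<le> 4 * sqrt (L * (K * \<delta>))"
            using grad_x_g_Hoelder[OF range(2) \<tau>T(3), of x] by linarith
        qed
        also have "\<dots> \<le> L * ((sqrt T * sqrt \<delta>) * (1 + A)) + 4 * sqrt (L * (K * \<delta>))"
          using \<delta>_le A L by (intro add_right_mono mult_left_mono mult_right_mono) auto
        also have "\<dots> = (L * (1 + A) * sqrt T + 4 * sqrt (L * K)) * sqrt \<delta>"
          by (simp add: real_sqrt_mult algebra_simps)
        finally have dg: "norm (grad_x g (\<tau>, z) - grad_x g (s, x)) \<le> (L * (1 + A) * sqrt T + 4 * sqrt (L * K)) * sqrt \<delta>" .
        have "norm (grad H (grad_x g (\<tau>, z)) - v) \<le> A * norm (grad_x g (\<tau>, z) - grad_x g (s, x))"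
          unfolding v_def by (intro H_grad_lip gK grad_x_g_in_cball range)
        also have "\<dots> \<le> A * ((L * (1 + A) * sqrt T + 4 * sqrt (L * K)) * sqrt \<delta>)"
          using dg A by (rule mult_left_mono)
        finally have dH: "norm (grad H (grad_x g (\<tau>, z)) - v) \<le> A * ((L * (1 + A) * sqrt T + 4 * sqrt (L * K)) * sqrt \<delta>)" .
        have "norm (Dw (\<tau>, z)) \<le> norm (grad_x f (\<tau>, z)) + norm (grad_x g (\<tau>, z))"
          unfolding Dw_def by (rule norm_triangle_ineq4)
        then have Dw: "norm (Dw (\<tau>, z)) \<le> 2 * K" using gp(1) gK by simp
        have "(norm (Dw (\<tau>, z)))\<^sup>2 \<le> 4 * (C + L) * (w (\<tau>, z) - 0)"
          using \<tau>T by (intro gp(3) w_nonneg) auto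
        also have "\<dots> \<le> 4 * (C + L) * (a s + 2 * K * (sqrt T * sqrt \<delta>))"
        proof (rule mult_left_mono)
          have "w (\<tau>, z) \<le> w (s, z) + 2 * K * \<delta>"
            using w_dist[OF \<tau>T(2) range(1), of z z] mult_left_mono[OF \<tau>T(4), of "2 * K"] K_nonneg
            by (simp add: abs_le_iff)
          also have "\<dots> \<le> a s + 2 * K * (sqrt T * sqrt \<delta>)"
            using upper[OF range(1), of z] \<delta>_le K_nonneg by (intro add_mono mult_left_mono) auto
          finally show "w (\<tau>, z) - 0 \<le> a s + 2 * K * (sqrt T * sqrt \<delta>)" by simp
        qed (use C L in auto)
        finally have "A * (norm (Dw (\<tau>, z)))\<^sup>2 \<le> A * (4 * (C + L) * (a s + 2 * K * (sqrt T * sqrt \<delta>)))"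
          using A by (rule mult_left_mono)
        also have "\<dots> = B * a s + B * (2 * K * sqrt T) * sqrt \<delta>"
          by (simp add: B_def algebra_simps)
        finally have quad: "A * (norm (Dw (\<tau>, z)))\<^sup>2 \<le> B * a s + B * (2 * K * sqrt T) * sqrt \<delta>" .
        \<comment> \<open>The left side is the derivative of \<open>w\<close> along the line with
          direction \<open>(1, - v)\<close>. Expanding \<open>H\<close> at the gradient of
          \<open>g\<close> leaves the velocity error paired with \<open>Dw\<close> and the quadratic
          remainder.\<close>
        have "H (grad_x f (\<tau>, z)) - H (grad_x g (\<tau>, z)) - v \<bullet> Dw (\<tau>, z)
            \<le> Dw (\<tau>, z) \<bullet> (grad H (grad_x g (\<tau>, z)) - v) + A * (norm (Dw (\<tau>, z)))\<^sup>2"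
          using H_Taylor[OF gp(1) gK] by (simp add: Dw_def inner_diff_right inner_commute)
        also have "Dw (\<tau>, z) \<bullet> (grad H (grad_x g (\<tau>, z)) - v) \<le> norm (Dw (\<tau>, z)) * norm (grad H (grad_x g (\<tau>, z)) - v)"
          by (rule norm_cauchy_schwarz)
        also have "\<dots> \<le> 2 * K * (A * ((L * (1 + A) * sqrt T + 4 * sqrt (L * K)) * sqrt \<delta>))"
          using Dw dH K_nonneg by (intro mult_mono) auto
        finally have "H (grad_x f (\<tau>, z)) - H (grad_x g (\<tau>, z)) - v \<bullet> Dw (\<tau>, z) \<le> B * a s + E * sqrt \<delta>"
          using quad by (simp add: E_def algebra_simps)
        then show ?thesis
          unfolding z_def[symmetric]
          by (intro exI[of _ "\<lambda>q. q \<bullet> (H (grad_x f (\<tau>, z)) - H (grad_x g (\<tau>, z)), Dw (\<tau>, z))"] conjI gp(2)) simp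
      qed
      then show "\<exists>v. \<forall>\<tau>\<in>{s<..<t'}. \<forall>y. norm (y - x) < t' - s \<longrightarrow> (\<tau>, y + (t' - \<tau>) *\<^sub>R v) \<notin> N \<longrightarrow>
        (\<exists>u'. (w has_derivative u') (at (\<tau>, y + (t' - \<tau>) *\<^sub>R v)) \<and> u' (1, - v) \<le> B * (SUP x. w (s, x)) + E * sqrt \<delta>)"
        unfolding a_def \<delta>_def by blast
    qed (use st N in auto)
    then show "a t' \<le> (1 + B * (t' - s)) * a s + E * (t' - s) * sqrt (t' - s)"
      by (simp add: \<delta>_def algebra_simps)
  qed (use t A C L B K_nonneg T in \<open>auto simp: E_def\<close>)
  then show ?thesis using upper[of t x] t by fastforce
qed

lemma f_eq_g:
  assumes "t \<in> {0..T}"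
  shows "f (t, x) = g (t, x)"
  using w_nonneg[of t x] w_nonpos[of t x] init assms by (cases "t = 0") (auto simp: w_def)

end

section \<open>Semiconcavity of \<open>g\<close> and conclusion\<close>

text \<open>By Cauchy-Schwarz the gradient \<open>L *\<^sub>R x - G x\<close> is monotone.\<close>

lemma convex_on_quadratic_minus:
  fixes u :: "'a::euclidean_space \<Rightarrow> real"
  assumes G: "\<And>x. GDERIV u x :> G x" and L: "\<And>x y. norm (G x - G y) \<le> L * norm (x - y)"
  shows "convex_on UNIV (\<lambda>x. L / 2 * (norm x)\<^sup>2 - u x)"
proof (rule convex_on_monotone_gradient)
  fix x y
  have "((\<lambda>x. L / 2 * (x \<bullet> x) - u x) has_derivative (\<lambda>h. h \<bullet> (L *\<^sub>R x - G x))) (at x)"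
    using G[of x] unfolding gderiv_def
    by (auto intro!: derivative_eq_intros simp: inner_commute algebra_simps)
  then show "GDERIV (\<lambda>x. L / 2 * (norm x)\<^sup>2 - u x) x :> L *\<^sub>R x - G x"
    by (simp add: gderiv_def power2_norm_eq_inner)
  have "(x - y) \<bullet> (G x - G y) \<le> norm (x - y) * norm (G x - G y)"
    by (rule norm_cauchy_schwarz)
  also have "\<dots> \<le> norm (x - y) * (L * norm (x - y))"
    using L by (rule mult_left_mono) simp
  also have "\<dots> = L * ((x - y) \<bullet> (x - y))"
    by (simp add: power2_norm_eq_inner[symmetric] power2_eq_square)
  finally have "0 \<le> (x - y) \<bullet> (L *\<^sub>R (x - y) - (G x - G y))"
    by (simp only: inner_diff_right[of _ "L *\<^sub>R (x - y)"] inner_scaleR_right)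
  then show "0 \<le> (x - y) \<bullet> (L *\<^sub>R x - G x - (L *\<^sub>R y - G y))"
    by (simp add: algebra_simps)
qed

theorem theorem1p1:
  fixes H \<psi> :: "real ^ 'n \<Rightarrow> real"
    and g :: "real \<times> (real ^ 'n) \<Rightarrow> real"
    and T L :: real
  assumes "Ck_on 2 H UNIV"
    and "lipschitz_fun_on \<psi> UNIV"
    and "\<forall>x. \<psi> differentiable (at x)"
    and "lipschitz_fun_on (grad \<psi>) UNIV"
    and "viscosity_solution H \<psi> g"
    and "lipschitz_fun_on g ({0..} \<times> UNIV)"
    and "T > 0"
    and "\<forall>p\<in>{0<..<T} \<times> UNIV. g differentiable (at p)"
    and "L \<ge> 0"
    and "\<forall>t\<in>{0..<T}. \<forall>x y. norm (grad_x g (t, x) - grad_x g (t, y)) \<le> L * norm (x - y)"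
  shows "(\<exists>!f. semiconcave_ae_solution T H \<psi> f) \<and>
         (THE f. semiconcave_ae_solution T H \<psi> f) = restrict g ({0..T} \<times> UNIV)"
proof -
  define G where "G = restrict g ({0..T} \<times> UNIV)"
  note H_grad = C2_gradient_Lipschitz(1)[OF assms(1)]
  obtain Kg where Kg: "Kg-lipschitz_on ({0..} \<times> UNIV) g"
    using assms(6) by (auto simp: lipschitz_fun_on_def)
  have g0: "g (0, x) = \<psi> x" for x
    using assms(5) by (simp add: viscosity_solution_def)
  have diff: "g differentiable (at (t, x))" if "t \<in> {0<..<T}" for t x
    using assms(8) that by auto
  have "continuous_on UNIV H"
    using H_grad unfolding gderiv_def
    by (intro differentiable_imp_continuous_on) (auto simp: differentiable_on_def differentiable_def)
  then have pde: "dt g (t, x) = H (grad_x g (t, x))" if "t \<in> {0<..<T}" for t x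
    using that diff by (intro viscosity_solution_classical[OF assms(5)]) auto
  \<comment> \<open>Joint differentiability is only given at positive times; at time 0 the slice is
    \<open>\<psi>\<close> itself.\<close>
  have g_grad: "GDERIV (\<lambda>x. g (t, x)) x :> grad_x g (t, x)" if t: "t \<in> {0..<T}" for t x
  proof (cases "t = 0")
    case True
    then show ?thesis using assms(3) GDERIV_grad[of \<psi> x] by (simp add: g0 grad_x_def)
  next
    case False
    then show ?thesis using diff[of t x] t has_derivative_dt_grad_x(2) by (auto simp: differentiable_def)
  qed
  \<comment> \<open>\<open>L\<close> may be 0, whereas the semiconcavity constant and the parameter
    of the locale have to be positive; hence \<open>L + 1\<close>.\<close>
  have g_grad_lip: "norm (grad_x g (t, x) - grad_x g (t, y)) \<le> (L + 1) * norm (x - y)" if "t \<in> {0..<T}" for t x y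
    using assms(10)[rule_format, OF that, of x y] by (simp add: distrib_right add_increasing2)

  have "semiconcave_ae_solution T H \<psi> G"
    unfolding semiconcave_ae_solution_def
  proof (intro conjI)
    show "G \<in> extensional ({0..T} \<times> UNIV)" by (simp add: G_def)
    have "Kg-lipschitz_on ({0..T} \<times> UNIV) g" using Kg by (rule lipschitz_on_subset) auto
    then have "Kg-lipschitz_on ({0..T} \<times> UNIV) G" unfolding G_def lipschitz_on_def by auto
    then show "lipschitz_fun_on G ({0..T} \<times> UNIV)" by (auto simp: lipschitz_fun_on_def)
    show "\<forall>x. G (0, x) = \<psi> x" using assms(7) by (simp add: G_def g0)
    have "G differentiable (at p) \<and> dt G p - H (grad_x G p) = 0" if p_in: "p \<in> {0<..<T} \<times> UNIV" for p
    proof -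
      obtain t x where p: "p = (t, x)" "t \<in> {0<..<T}" using p_in by (cases p) auto
      obtain g' where g': "(g has_derivative g') (at (t, x))"
        using diff[OF p(2)] by (auto simp: differentiable_def)
      \<comment> \<open>\<open>G\<close> agrees with \<open>g\<close> on the open strip, a
        neighbourhood of the point, so the derivative carries over.\<close>
      have G': "(G has_derivative g') (at (t, x))"
        by (rule has_derivative_transform_within_open[OF g', of "{0<..<T} \<times> UNIV"])
          (use p in \<open>auto simp: G_def open_Times\<close>)
      have "(\<lambda>q. q \<bullet> (dt G (t, x), grad_x G (t, x))) = (\<lambda>q. q \<bullet> (dt g (t, x), grad_x g (t, x)))"
        using has_derivative_dt_grad_x(1)[OF G'] has_derivative_dt_grad_x(1)[OF g'] by simp
      then have "(dt G (t, x), grad_x G (t, x)) = (dt g (t, x), grad_x g (t, x))"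
        by (metis vector_eq_ldot)
      then show ?thesis using pde[OF p(2), of x] G' p by (auto simp: differentiable_def)
    qed
    then show "AE p in lebesgue. p \<in> {0<..<T} \<times> UNIV \<longrightarrow>
        G differentiable (at p) \<and> dt G p - H (grad_x G p) = 0" by simp
    have "convex_on UNIV (\<lambda>x. (L + 1) / 2 * (norm x)\<^sup>2 - g (t, x))" if "t \<in> {0..<T}" for t
      using g_grad[OF that] g_grad_lip[OF that] by (rule convex_on_quadratic_minus)
    then show "\<exists>c>0. \<forall>t\<in>{0..<T}. convex_on UNIV (\<lambda>x. c / 2 * (norm x)\<^sup>2 - G (t, x))"
      using assms(9) by (intro exI[of _ "L + 1"]) (auto simp: G_def)
  qed
  moreover have "f = G" if f: "semiconcave_ae_solution T H \<psi> f" for f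
  proof (rule extensionalityI[of _ "{0..T} \<times> UNIV"])
    show "f \<in> extensional ({0..T} \<times> UNIV)" "G \<in> extensional ({0..T} \<times> UNIV)"
      using f by (auto simp: semiconcave_ae_solution_def G_def)
    obtain Kf where Kf: "Kf-lipschitz_on ({0..T} \<times> UNIV) f"
      using f by (auto simp: semiconcave_ae_solution_def lipschitz_fun_on_def)
    obtain c where c: "c > 0" "\<And>t. t \<in> {0..<T} \<Longrightarrow> convex_on UNIV (\<lambda>x. c / 2 * (norm x)\<^sup>2 - f (t, x))"
      using f by (auto simp: semiconcave_ae_solution_def)
    define K where "K = max Kf Kg"
    obtain A0 where A0: "A0 \<ge> 0" "\<And>p q. p \<in> cball 0 K \<Longrightarrow> q \<in> cball 0 K \<Longrightarrow>
        norm (grad H p - grad H q) \<le> A0 * norm (p - q)"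
      using C2_gradient_Lipschitz(2)[OF assms(1), of K] by blast
    have K0: "K \<ge> 0" using lipschitz_on_nonneg[OF Kf] by (simp add: K_def)
    \<comment> \<open>\<open>A0\<close> is a Lipschitz constant of the gradient of \<open>H\<close>
      on the ball, and the bracket bounds its norm there by comparison with the centre; the sum
      serves both purposes.\<close>
    define A where "A = A0 + (norm (grad H 0) + A0 * K)"
    define N where "N = {p. \<not> (p \<in> {0<..<T} \<times> UNIV \<longrightarrow> f differentiable (at p) \<and> dt f p - H (grad_x f p) = 0)}"
    interpret weak_strong_pair H f g T K "L + 1" A "c / 2" N
    proof
      show "K-lipschitz_on ({0..T} \<times> UNIV) f" by (rule lipschitz_on_le[OF Kf]) (simp add: K_def)
      have "K-lipschitz_on ({0..} \<times> UNIV) g" by (rule lipschitz_on_le[OF Kg]) (simp add: K_def)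
      then show "K-lipschitz_on ({0..T} \<times> UNIV) g" by (rule lipschitz_on_subset) auto
      show "negligible N"
        using f by (simp add: negligible_iff_AE N_def semiconcave_ae_solution_def)
      show "f (0, x) = g (0, x)" for x using f by (simp add: semiconcave_ae_solution_def g0)
      show "norm (grad H p - grad H q) \<le> A * norm (p - q)" if "p \<in> cball 0 K" "q \<in> cball 0 K" for p q
      proof -
        have "A0 * norm (p - q) \<le> A * norm (p - q)"
          using A0(1) K0 by (intro mult_right_mono) (auto simp: A_def)
        then show ?thesis using A0(2)[OF that] by linarith
      qed
      show "norm (grad H p) \<le> A" if p: "p \<in> cball 0 K" for p
      proof -
        have "norm (grad H p) \<le> norm (grad H 0) + norm (grad H p - grad H 0)"
          by (rule norm_triangle_sub)
        also have "\<dots> \<le> norm (grad H 0) + A0 * K"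
          using A0(2)[of p 0] mult_left_mono[of "norm p" K A0] A0(1) K0 p by simp
        finally show ?thesis using A0(1) by (simp add: A_def)
      qed
    qed (use assms(7,9) c A0(1) K0 H_grad diff pde g_grad g_grad_lip in \<open>auto simp: A_def N_def\<close>)
    show "f p = G p" if "p \<in> {0..T} \<times> UNIV" for p
      using f_eq_g that by (auto simp: G_def)
  qed
  ultimately have "\<exists>!f. semiconcave_ae_solution T H \<psi> f" "(THE f. semiconcave_ae_solution T H \<psi> f) = G"
    by (blast intro: the_equality)+
  then show ?thesis by (simp add: G_def)
qed

end
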